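(* The class of EDS is not closed under topological factor maps. That is, there exist a finitely generated group $\Gamma$, an EDS $\Gamma\curvearrowright X$, and an action $\Gamma\curvearrowright Y$ by homeomorphisms on a compact metrizable space which is a topological factor of $\Gamma\curvearrowright X$ and is not an EDS.
   Context: A topological factor map from $\Gamma\curvearrowright X$ to $\Gamma\curvearrowright Y$ is a continuous surjective $\Gamma$-equivariant map $X\to Y$ (then $\Gamma\curvearrowright Y$ is a topological factor of $\Gamma\curvearrowright X$); it is a topological conjugacy if it is a homeomorphism. A computable metric space is $(X,d,\mathcal{S})$ where $(X,d)$ is a separable metric space, $\mathcal{S}=\{s_i: i\ge 0\}$ is dense, and there is an algorithm which on input $(i,j,n)$ outputs $r\in\mathbb{Q}$ with $|d(s_i,s_j)-r|\le 2^{-n}$. Basic balls are open balls centered at points of $\mathcal{S}$ with positive rational radius; fix a computable enumeration $(B_n)_{n\in\mathbb{N}}$ of them and put $U_I=\bigcup_{n\in I}B_n$. A compact set $K\subset X$ is recursively compact if there is an algorithm which, given a finite $I\subset\mathbb{N}$, halts iff $K\subset U_I$. A map $f\colon Y\subset X\to X'$ between computable metric spaces is computable if there is an algorithm which, given $m$, enumerates $I_m$ with $f^{-1}(B'_m)=U_{I_m}\cap Y$, where $(B'_m)_m$ enumerates the basic balls of $X'$. An action of a finitely generated group by homeomorphisms on a recursively compact subset of a computable metric space is computable if for some (equivalently any) finite generating set each generator acts by a computable map. An action of a finitely generated group on a compact metrizable space is an effective dynamical system (EDS) if it is topologically conjugate to a computable action on some recursively compact subset of a computable metric space (the conjugacy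 need not be computable). *)

theory Defs
  imports "HOL-Analysis.Analysis" "HOL-Algebra.Group_Action" "HOL-Algebra.Generated_Groups"
    "HOL-Library.Nat_Bijection"
begin

section \<open>Algorithms\<close>

text \<open>
  Algorithms are codes of partial recursive functions on tuples of natural numbers. The
  proposition \<open>computes p xs y\<close> says that \<open>p\<close> halts on input \<open>xs\<close> with output \<open>y\<close>; a code
  used with an unsuitable number of arguments simply does not halt.
\<close>

datatype recf =
    Zero
  | Succ
  | Proj nat
  | Comp recf "recf list"
  | PrimRec recf recf
  | Mu recf

inductive computes :: "recf \<Rightarrow> nat list \<Rightarrow> nat \<Rightarrow> bool" where
  zero: "computes Zero xs 0"
| succ: "computes Succ [x] (Suc x)"
| proj: "i < length xs \<Longrightarrow> computes (Proj i) xs (xs ! i)"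
| comp: "length ys = length gs \<Longrightarrow> (\<And>i. i < length gs \<Longrightarrow> computes (gs ! i) xs (ys ! i)) \<Longrightarrow>
    computes f ys z \<Longrightarrow> computes (Comp f gs) xs z"
| prim_0: "computes f xs y \<Longrightarrow> computes (PrimRec f g) (0 # xs) y"
| prim_Suc: "computes (PrimRec f g) (n # xs) y \<Longrightarrow> computes g (n # y # xs) z \<Longrightarrow>
    computes (PrimRec f g) (Suc n # xs) z"
| mu: "computes f (n # xs) 0 \<Longrightarrow> (\<And>m. m < n \<Longrightarrow> \<exists>k. computes f (m # xs) (Suc k)) \<Longrightarrow>
    computes (Mu f) xs n"

lemma computes_unique: "computes p xs y \<Longrightarrow> computes p xs z \<Longrightarrow> y = z"
proof (induction arbitrary: z rule: computes.induct)
  case (zero xs)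
  then show ?case by (auto elim: computes.cases)
next
  case (succ x)
  then show ?case by (auto elim: computes.cases)
next
  case (proj i xs)
  from proj.prems show ?case by (auto elim: computes.cases)
next
  case (comp ys gs xs f y)
  from comp.prems obtain ys' where *: "length ys' = length gs"
    "\<And>i. i < length gs \<Longrightarrow> computes (gs ! i) xs (ys' ! i)" "computes f ys' z"
    by (auto elim: computes.cases)
  have "ys = ys'"
    using * comp by (intro nth_equalityI) auto
  with * comp show ?case by auto
next
  case (prim_0 f xs y g)
  from prim_0.prems show ?case by (cases) (use prim_0.IH in auto)
next
  case (prim_Suc f g n xs y w)
  from prim_Suc.prems show ?case by (cases) (use prim_Suc.IH in blast)
next
  case (mu f n xs)
  from mu.prems obtain *: "computes f (z # xs) 0"
    "\<And>m. m < z \<Longrightarrow> \<exists>k. computes f (m # xs) (Suc k)"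
    by cases auto
  show ?case
  proof (rule linorder_cases[of n z])
    assume "n < z"
    with *(2) mu.IH(1) show ?thesis by blast
  next
    assume "z < n"
    with mu.IH(2) *(1) show ?thesis by blast
  qed
qed

definition halts :: "recf \<Rightarrow> nat list \<Rightarrow> bool" where
  "halts p xs \<longleftrightarrow> (\<exists>y. computes p xs y)"

text \<open>
  The set enumerated by \<open>p\<close> on input \<open>m\<close>: all outputs of the computations with inputs
  \<open>m, 0\<close>; \<open>m, 1\<close>; \<open>m, 2\<close>; and so on. As these need not halt, the set may be empty.
\<close>
definition enumerated :: "recf \<Rightarrow> nat \<Rightarrow> nat set" where
  "enumerated p m = {n. \<exists>k. computes p [m, k] n}"

definition rat_decode :: "nat \<Rightarrow> rat" where
  "rat_decode n = (case prod_decode n of (a, b) \<Rightarrow> Fract (int_decode a) (int (Suc b)))"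

definition pos_rat_decode :: "nat \<Rightarrow> rat" where
  "pos_rat_decode n = (case prod_decode n of (a, b) \<Rightarrow> Fract (int (Suc a)) (int (Suc b)))"

lemma surj_rat_decode: "surj rat_decode"
proof (rule surjI)
  fix r :: rat
  obtain a b where ab: "r = Fract a b" "b > 0"
    by (cases r) auto
  then have "rat_decode (prod_encode (int_encode a, nat b - 1)) = r"
    by (simp add: rat_decode_def)
  then show "rat_decode (SOME n. rat_decode n = r) = r"
    by (rule someI)
qed

lemma range_pos_rat_decode: "range pos_rat_decode = {r. 0 < r}"
proof (intro equalityI subsetI)
  fix r :: rat assume "r \<in> {r. 0 < r}"
  then obtain a b where ab: "r = Fract a b" "b > 0" "a > 0"
    by (cases r) (auto simp: zero_less_Fract_iff)
  then have "pos_rat_decode (prod_encode (nat a - 1, nat b - 1)) = r"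
    by (simp add: pos_rat_decode_def)
  then show "r \<in> range pos_rat_decode"
    by blast
qed (auto simp: pos_rat_decode_def zero_less_Fract_iff split: prod.split)


section \<open>Computable metric spaces\<close>

locale computable_metric_space = Metric_space M d
  for M :: "'a set" and d :: "'a \<Rightarrow> 'a \<Rightarrow> real" +
  fixes s :: "nat \<Rightarrow> 'a"
  assumes range_s: "range s \<subseteq> M"
    and dense: "mtopology closure_of (range s) = M"
    and computable_dist: "\<exists>p. \<forall>i j n. \<exists>c. computes p [i, j, n] c \<and>
      \<bar>d (s i) (s j) - of_rat (rat_decode c)\<bar> \<le> 1 / 2 ^ n"

definition basic_ball :: "'a set \<Rightarrow> ('a \<Rightarrow> 'a \<Rightarrow> real) \<Rightarrow> (nat \<Rightarrow> 'a) \<Rightarrow> nat \<Rightarrow> 'a set" where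
  "basic_ball M d s n =
    (case prod_decode n of (i, j) \<Rightarrow> Metric_space.mball M d (s i) (of_rat (pos_rat_decode j)))"

definition recursively_compact ::
  "'a set \<Rightarrow> ('a \<Rightarrow> 'a \<Rightarrow> real) \<Rightarrow> (nat \<Rightarrow> 'a) \<Rightarrow> 'a set \<Rightarrow> bool" where
  "recursively_compact M d s K \<longleftrightarrow>
    compactin (Metric_space.mtopology M d) K \<and>
    (\<exists>p. \<forall>I. finite I \<longrightarrow> (halts p [set_encode I] \<longleftrightarrow> K \<subseteq> (\<Union>n\<in>I. basic_ball M d s n)))"

definition computable_map ::
  "'a set \<Rightarrow> ('a \<Rightarrow> 'a \<Rightarrow> real) \<Rightarrow> (nat \<Rightarrow> 'a) \<Rightarrow> 'a set \<Rightarrow>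
   'b set \<Rightarrow> ('b \<Rightarrow> 'b \<Rightarrow> real) \<Rightarrow> (nat \<Rightarrow> 'b) \<Rightarrow> ('a \<Rightarrow> 'b) \<Rightarrow> bool" where
  "computable_map M d s Y M' d' s' f \<longleftrightarrow>
    Y \<subseteq> M \<and> f ` Y \<subseteq> M' \<and>
    (\<exists>p. \<forall>m. {y \<in> Y. f y \<in> basic_ball M' d' s' m} =
      (\<Union>n\<in>enumerated p m. basic_ball M d s n) \<inter> Y)"


section \<open>Group actions\<close>

definition generating_set :: "('g, 'm) monoid_scheme \<Rightarrow> 'g set \<Rightarrow> bool" where
  "generating_set G S \<longleftrightarrow> S \<subseteq> carrier G \<and> generate G S = carrier G"

definition finitely_generated :: "('g, 'm) monoid_scheme \<Rightarrow> bool" where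
  "finitely_generated G \<longleftrightarrow> group G \<and> (\<exists>S. finite S \<and> generating_set G S)"

definition topological_action ::
  "('g, 'm) monoid_scheme \<Rightarrow> 'a topology \<Rightarrow> ('g \<Rightarrow> 'a \<Rightarrow> 'a) \<Rightarrow> bool" where
  "topological_action G X \<phi> \<longleftrightarrow>
    group_action G (topspace X) \<phi> \<and> (\<forall>g\<in>carrier G. homeomorphic_map X X (\<phi> g))"

definition topological_factor_map ::
  "('g, 'm) monoid_scheme \<Rightarrow> 'a topology \<Rightarrow> ('g \<Rightarrow> 'a \<Rightarrow> 'a) \<Rightarrow>
   'b topology \<Rightarrow> ('g \<Rightarrow> 'b \<Rightarrow> 'b) \<Rightarrow> ('a \<Rightarrow> 'b) \<Rightarrow> bool" where
  "topological_factor_map G X \<phi> Y \<psi> f \<longleftrightarrow>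
    continuous_map X Y f \<and> f ` topspace X = topspace Y \<and>
    (\<forall>g\<in>carrier G. \<forall>x\<in>topspace X. f (\<phi> g x) = \<psi> g (f x))"

definition topological_conjugacy ::
  "('g, 'm) monoid_scheme \<Rightarrow> 'a topology \<Rightarrow> ('g \<Rightarrow> 'a \<Rightarrow> 'a) \<Rightarrow>
   'b topology \<Rightarrow> ('g \<Rightarrow> 'b \<Rightarrow> 'b) \<Rightarrow> ('a \<Rightarrow> 'b) \<Rightarrow> bool" where
  "topological_conjugacy G X \<phi> Y \<psi> f \<longleftrightarrow>
    topological_factor_map G X \<phi> Y \<psi> f \<and> homeomorphic_map X Y f"

definition computable_action ::
  "('g, 'm) monoid_scheme \<Rightarrow> 'a set \<Rightarrow> ('a \<Rightarrow> 'a \<Rightarrow> real) \<Rightarrow> (nat \<Rightarrow> 'a) \<Rightarrow> 'a set \<Rightarrow>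
   ('g \<Rightarrow> 'a \<Rightarrow> 'a) \<Rightarrow> bool" where
  "computable_action G M d s K \<phi> \<longleftrightarrow>
    computable_metric_space M d s \<and> recursively_compact M d s K \<and>
    topological_action G (subtopology (Metric_space.mtopology M d) K) \<phi> \<and>
    (\<exists>S. finite S \<and> generating_set G S \<and> (\<forall>g\<in>S. computable_map M d s K M d s (\<phi> g)))"

text \<open>
  A definition cannot quantify over the type of the points of the computable metric space. The
  type \<^typ>\<open>nat \<Rightarrow> real\<close> loses nothing: a point \<open>x\<close> of a separable metric space is determined
  by its distances \<open>d x (s i)\<close> to a dense sequence. The lemma
  \<open>effective_dynamical_systemI\<close> below shows that computable metric spaces with
  points in any other type yield the same notion.
\<close>
definition effective_dynamical_system ::
  "('g, 'm) monoid_scheme \<Rightarrow> 'a topology \<Rightarrow> ('g \<Rightarrow> 'a \<Rightarrow> 'a) \<Rightarrow> bool" where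
  "effective_dynamical_system G X \<phi> \<longleftrightarrow>
    finitely_generated G \<and> compact_space X \<and> metrizable_space X \<and> topological_action G X \<phi> \<and>
    (\<exists>(M :: (nat \<Rightarrow> real) set) d s K \<psi> h.
      computable_action G M d s K \<psi> \<and>
      topological_conjugacy G X \<phi> (subtopology (Metric_space.mtopology M d) K) \<psi> h)"

lemma effective_dynamical_systemI:
  fixes M :: "'c set" and X :: "'a topology"
  assumes fg: "finitely_generated G" and X: "compact_space X" "metrizable_space X"
    and \<phi>: "topological_action G X \<phi>"
    and act: "computable_action G M d s K \<psi>"
    and conj: "topological_conjugacy G X \<phi> (subtopology (Metric_space.mtopology M d) K) \<psi> h"
  shows "effective_dynamical_system G X \<phi>"
proof -
  interpret computable_metric_space M d s
    using act by (simp add: computable_action_def)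
  define f :: "'c \<Rightarrow> nat \<Rightarrow> real" where "f = (\<lambda>x i. d x (s i))"
  have sM: "s i \<in> M" for i
    using range_s by blast
  have inj: "inj_on f M"
  proof (rule inj_onI, rule ccontr)
    fix x y assume xy: "x \<in> M" "y \<in> M" "f x = f y" "x \<noteq> y"
    then have pos: "0 < d x y / 2"
      by simp
    have "x \<in> mtopology closure_of (range s)"
      using dense xy by simp
    then obtain i where i: "d x (s i) < d x y / 2"
      using pos unfolding metric_closure_of by (fastforce simp: in_mball)
    moreover have "d y (s i) = d x (s i)"
      using xy(3) by (simp add: f_def fun_eq_iff)
    moreover have "d x y \<le> d x (s i) + d y (s i)"
      using triangle[OF xy(1) sM xy(2)] commute by metis
    ultimately show False by simp
  qed
  define g where "g = inv_into M f"
  define M' where "M' = f ` M"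
  define d' where "d' = (\<lambda>u v. d (g u) (g v))"
  define s' where "s' = f \<circ> s"
  define K' where "K' = f ` K"
  define \<psi>' where "\<psi>' = (\<lambda>a. \<lambda>u\<in>K'. f (\<psi> a (g u)))"
  have gf [simp]: "g (f x) = x" if "x \<in> M" for x
    using that inj by (simp add: g_def)
  have fg' [simp]: "f (g u) = u" if "u \<in> M'" for u
    using that by (auto simp: M'_def)
  have fM [simp]: "f x \<in> M'" if "x \<in> M" for x
    using that by (simp add: M'_def)
  interpret M': Metric_space M' d'
    by unfold_locales (auto simp: d'_def M'_def commute triangle)
  have d'f: "d' (f x) (f y) = d x y" if "x \<in> M" "y \<in> M" for x y
    using that by (simp add: d'_def)
  have ball: "M'.mball (f x) r = f ` mball x r" if "x \<in> M" for x r
    using that unfolding M'.mball_def mball_def by (auto simp: M'_def d'f)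
  have KM: "K \<subseteq> M" and Kc: "compactin mtopology K"
    using act compactin_subset_topspace[of mtopology K]
    by (auto simp: computable_action_def recursively_compact_def)
  have contf: "continuous_map mtopology M'.mtopology f"
    unfolding metric_continuous_map[OF M'.Metric_space_axioms]
    by (auto simp: M'_def d'f)
  have contg: "continuous_map M'.mtopology mtopology g"
    unfolding M'.metric_continuous_map[OF Metric_space_axioms]
    by (auto simp: M'_def d'f)
  have homf: "homeomorphic_maps mtopology M'.mtopology f g"
    using contf contg by (simp add: homeomorphic_maps_def)
  let ?T = "subtopology mtopology K" and ?T' = "subtopology M'.mtopology K'"
  have MK [simp]: "M \<inter> K = K" "M' \<inter> K' = K'"
    using KM by (auto simp: K'_def)
  have homK: "homeomorphic_maps ?T ?T' f g"
    using homf by (rule homeomorphic_maps_subtopologies) (use KM in \<open>auto simp: K'_def\<close>)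
  have homfK: "homeomorphic_map ?T ?T' f" and homgK: "homeomorphic_map ?T' ?T g"
    using homK homeomorphic_maps_map by blast+
  have gK: "g u \<in> K" "f (g u) = u" if "u \<in> K'" for u
    using that KM by (auto simp: K'_def)
  have ta: "topological_action G ?T \<psi>"
    using act by (simp add: computable_action_def)
  interpret \<psi>: group_action G K \<psi>
    using ta by (simp add: topological_action_def)
  have \<psi>K: "\<psi> a x \<in> K" if "a \<in> carrier G" "x \<in> K" for a x
    using \<psi>.element_image that by blast
  have homeo': "homeomorphic_map ?T' ?T' (\<psi>' a)" if a: "a \<in> carrier G" for a
  proof -
    have "homeomorphic_map ?T ?T (\<psi> a)"
      using ta a by (simp add: topological_action_def)
    then have "homeomorphic_map ?T' ?T' (f \<circ> (\<psi> a \<circ> g))"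
      by (intro homeomorphic_map_compose[OF _ homfK] homeomorphic_map_compose[OF homgK])
    then show ?thesis
      by (rule homeomorphic_map_eq) (simp add: \<psi>'_def)
  qed
  have bij': "\<psi>' a \<in> Bij K'" if a: "a \<in> carrier G" for a
    using homeomorphic_imp_injective_map[OF homeo'[OF a]] homeomorphic_imp_surjective_map[OF homeo'[OF a]]
    by (simp add: Bij_def bij_betw_def) (simp add: \<psi>'_def)
  have gr: "group G"
    using fg by (simp add: finitely_generated_def)
  have "\<psi>' (a \<otimes>\<^bsub>G\<^esub> b) = compose K' (\<psi>' a) (\<psi>' b)" if ab: "a \<in> carrier G" "b \<in> carrier G" for a b
  proof
    fix u
    show "\<psi>' (a \<otimes>\<^bsub>G\<^esub> b) u = compose K' (\<psi>' a) (\<psi>' b) u"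
    proof (cases "u \<in> K'")
      case True
      then have "\<psi> b (g u) \<in> K"
        using gK \<psi>K ab by blast
      with True show ?thesis
        using ab KM by (auto simp: \<psi>'_def compose_def \<psi>.composition_rule gK K'_def)
    qed (simp add: \<psi>'_def compose_def)
  qed
  then have "group_hom G (BijGroup K') \<psi>'"
    using gr bij' group_BijGroup[of K']
    by (auto simp: group_hom_def group_hom_axioms_def hom_def BijGroup_def)
  then have ga': "group_action G K' \<psi>'"
    by (simp add: group_action_def)
  have ta': "topological_action G ?T' \<psi>'"
    using ga' homeo' by (simp add: topological_action_def)
  have cms': "computable_metric_space M' d' s'"
  proof
    show "range s' \<subseteq> M'"
      using range_s by (auto simp: s'_def M'_def)
    have "homeomorphic_map mtopology M'.mtopology f"
      using homf homeomorphic_maps_map by blast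
    then have "M'.mtopology closure_of (f ` range s) = f ` (mtopology closure_of range s)"
      using range_s by (intro homeomorphic_map_closure_of) auto
    then show "M'.mtopology closure_of range s' = M'"
      by (simp add: s'_def M'_def dense image_comp)
    show "\<exists>p. \<forall>i j n. \<exists>c. computes p [i, j, n] c \<and>
        \<bar>d' (s' i) (s' j) - of_rat (rat_decode c)\<bar> \<le> 1 / 2 ^ n"
      using computable_dist by (simp add: s'_def d'f sM)
  qed
  have bb: "basic_ball M' d' s' n = f ` basic_ball M d s n" for n
    by (simp add: basic_ball_def s'_def ball sM split: prod.split)
  have bM: "basic_ball M d s n \<subseteq> M" for n
    by (auto simp: basic_ball_def in_mball split: prod.split)
  have mem: "f x \<in> basic_ball M' d' s' n \<longleftrightarrow> x \<in> basic_ball M d s n" if "x \<in> M" for x n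
    using that bM inj unfolding bb by (blast dest: inj_onD)
  have sub: "K' \<subseteq> (\<Union>n\<in>I. basic_ball M' d' s' n) \<longleftrightarrow> K \<subseteq> (\<Union>n\<in>I. basic_ball M d s n)" for I
  proof -
    have "K' \<subseteq> (\<Union>n\<in>I. basic_ball M' d' s' n) \<longleftrightarrow>
        (\<forall>x\<in>K. \<exists>n\<in>I. f x \<in> basic_ball M' d' s' n)"
      by (auto simp: K'_def)
    also have "\<dots> \<longleftrightarrow> (\<forall>x\<in>K. \<exists>n\<in>I. x \<in> basic_ball M d s n)"
      using mem KM by (simp add: subset_iff)
    finally show ?thesis
      by auto
  qed
  have "compactin M'.mtopology K'"
    using image_compactin[OF Kc contf] by (simp add: K'_def)
  moreover obtain p where "\<forall>I. finite I \<longrightarrow> (halts p [set_encode I] \<longleftrightarrow> K \<subseteq> (\<Union>n\<in>I. basic_ball M d s n))"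
    using act by (auto simp: computable_action_def recursively_compact_def)
  ultimately have rc': "recursively_compact M' d' s' K'"
    unfolding recursively_compact_def sub by blast
  have cm': "computable_map M' d' s' K' M' d' s' (\<psi>' a)"
    if a: "a \<in> carrier G" and cm: "computable_map M d s K M d s (\<psi> a)" for a
  proof -
    obtain p where p: "\<And>m. {y \<in> K. \<psi> a y \<in> basic_ball M d s m} =
        (\<Union>n\<in>enumerated p m. basic_ball M d s n) \<inter> K"
      using cm by (auto simp: computable_map_def)
    have "{u \<in> K'. \<psi>' a u \<in> basic_ball M' d' s' m} =
        (\<Union>n\<in>enumerated p m. basic_ball M' d' s' n) \<inter> K'" for m
    proof -
      have "{u \<in> K'. \<psi>' a u \<in> basic_ball M' d' s' m} = f ` {y \<in> K. \<psi> a y \<in> basic_ball M d s m}"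
      proof -
        have "\<psi>' a (f x) \<in> basic_ball M' d' s' m \<longleftrightarrow> \<psi> a x \<in> basic_ball M d s m" if "x \<in> K" for x
        proof -
          have "x \<in> M" "\<psi> a x \<in> M" "f x \<in> K'"
            using that KM \<psi>K[OF a] by (auto simp: K'_def)
          then show ?thesis
            by (simp add: \<psi>'_def mem)
        qed
        then show ?thesis
          unfolding K'_def by blast
      qed
      also have "\<dots> = (\<Union>n\<in>enumerated p m. basic_ball M' d' s' n) \<inter> K'"
      proof -
        have "f x \<in> basic_ball M' d' s' n \<longleftrightarrow> x \<in> basic_ball M d s n" if "x \<in> K" for x n
          using that KM by (intro mem) auto
        then show ?thesis
          unfolding p K'_def by blast
      qed
      finally show ?thesis .
    qed
    moreover have "\<psi>' a ` K' \<subseteq> K'"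
      using bij'[OF a] by (auto simp: Bij_def bij_betw_def)
    moreover have "K' \<subseteq> M'"
      using KM by (auto simp: K'_def M'_def)
    ultimately show ?thesis
      unfolding computable_map_def by blast
  qed
  obtain S where S: "finite S" "generating_set G S" "\<forall>a\<in>S. computable_map M d s K M d s (\<psi> a)"
    using act by (auto simp: computable_action_def)
  then have "\<forall>a\<in>S. computable_map M' d' s' K' M' d' s' (\<psi>' a)"
    using cm' by (auto simp: generating_set_def)
  with S cms' rc' ta' have act': "computable_action G M' d' s' K' \<psi>'"
    unfolding computable_action_def by blast
  have h: "homeomorphic_map X ?T h" "\<And>a x. a \<in> carrier G \<Longrightarrow> x \<in> topspace X \<Longrightarrow> h (\<phi> a x) = \<psi> a (h x)"
    using conj by (auto simp: topological_conjugacy_def topological_factor_map_def)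
  have hK: "h x \<in> K" if "x \<in> topspace X" for x
    using homeomorphic_imp_surjective_map[OF h(1)] that by auto
  have hom: "homeomorphic_map X ?T' (f \<circ> h)"
    by (rule homeomorphic_map_compose[OF h(1) homfK])
  have "topological_conjugacy G X \<phi> ?T' \<psi>' (f \<circ> h)"
    unfolding topological_conjugacy_def topological_factor_map_def
  proof (intro conjI ballI)
    show "continuous_map X ?T' (f \<circ> h)"
      using hom homeomorphic_imp_continuous_map by blast
    show "(f \<circ> h) ` topspace X = topspace ?T'"
      using hom homeomorphic_imp_surjective_map by blast
    show "(f \<circ> h) (\<phi> a x) = \<psi>' a ((f \<circ> h) x)" if "a \<in> carrier G" "x \<in> topspace X" for a x
      using that hK[OF that(2)] KM h(2) by (auto simp: \<psi>'_def K'_def)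
  qed (rule hom)
  with fg X \<phi> act' show ?thesis
    unfolding effective_dynamical_system_def by blast
qed

end

theory Submission
  imports Defs "HOL-Library.Countable"
begin

text \<open>
  For a set \<open>A\<close> of natural numbers let the integers act on a compact space consisting of one
  orbit of size \<open>n + 2\<close> for every \<open>n \<in> A\<close>, with these finite orbits accumulating at a single
  fixed point. The system containing all the orbits is a computable isometric action, and
  collapsing the orbits with \<open>n \<notin> A\<close> to the fixed point is a factor map onto the system of
  \<open>A\<close>. A recursively compact set with a computable action is determined, up to an
  equivariant bijection, by the finitely many programs that witness its computability: by
  compactness, for every point of one copy there is a point of the other copy that lies in
  the same basic balls. Hence there are only countably many effective dynamical systems up to
  conjugacy, whereas \<open>A\<close> can be read off from the stabilizers of the points of its system.
\<close>


section \<open>Total recursive functions and decidable relations\<close>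

definition recursive_fun :: "nat \<Rightarrow> (nat list \<Rightarrow> nat) \<Rightarrow> bool" where
  "recursive_fun k f \<longleftrightarrow> (\<exists>p. \<forall>xs. length xs = k \<longrightarrow> computes p xs (f xs))"

text \<open>Truth is coded by 0 because \<open>Mu\<close> searches for a zero.\<close>

definition recursive_rel :: "nat \<Rightarrow> (nat list \<Rightarrow> bool) \<Rightarrow> bool" where
  "recursive_rel k P \<longleftrightarrow> recursive_fun k (\<lambda>xs. if P xs then 0 else 1)"

named_theorems recursive

lemma recursive_fun_cong:
  "recursive_fun k f \<Longrightarrow> (\<And>xs. length xs = k \<Longrightarrow> f xs = g xs) \<Longrightarrow> recursive_fun k g"
  unfolding recursive_fun_def by force

lemma recursive_rel_cong:
  "recursive_rel k P \<Longrightarrow> (\<And>xs. length xs = k \<Longrightarrow> P xs = Q xs) \<Longrightarrow> recursive_rel k Q"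
  unfolding recursive_rel_def by (erule recursive_fun_cong) auto

section \<open>Projections, composition and constants\<close>

lemma recursive_nth [recursive]: "i < k \<Longrightarrow> recursive_fun k (\<lambda>xs. xs ! i)"
  unfolding recursive_fun_def by (rule exI[of _ "Proj i"]) (auto intro: computes.proj)

text \<open>Each bounded quantifier puts its variable at the head of the argument list, so outer
  variables appear below \<open>tl\<close>. Three levels suffice for the nesting in
  \<open>covers_orbits\<close>; \<open>recursive_hd\<close> serves the quantified variables
  themselves.\<close>

lemma recursive_tl_nth [recursive]:
  "Suc i < k \<Longrightarrow> recursive_fun k (\<lambda>xs. tl xs ! i)"
  "Suc (Suc i) < k \<Longrightarrow> recursive_fun k (\<lambda>xs. tl (tl xs) ! i)"
  "Suc (Suc (Suc i)) < k \<Longrightarrow> recursive_fun k (\<lambda>xs. tl (tl (tl xs)) ! i)"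
  by (rule recursive_fun_cong[OF recursive_nth]; force simp: nth_tl)+

lemma recursive_hd [recursive]:
  "0 < k \<Longrightarrow> recursive_fun k (\<lambda>xs. hd xs)"
  "Suc 0 < k \<Longrightarrow> recursive_fun k (\<lambda>xs. hd (tl xs))"
  "Suc (Suc 0) < k \<Longrightarrow> recursive_fun k (\<lambda>xs. hd (tl (tl xs)))"
  by (rule recursive_fun_cong[OF recursive_nth], assumption,
      use hd_drop_conv_nth[of 0] hd_drop_conv_nth[of "Suc 0"] hd_drop_conv_nth[of "Suc (Suc 0)"]
      in \<open>force simp: drop_Suc\<close>)+

lemma recursive_compose:
  assumes "recursive_fun (length gs) f" "\<And>g. g \<in> set gs \<Longrightarrow> recursive_fun k g"
  shows "recursive_fun k (\<lambda>xs. f (map (\<lambda>g. g xs) gs))"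
proof -
  obtain p where p: "\<And>ys. length ys = length gs \<Longrightarrow> computes p ys (f ys)"
    using assms(1) by (auto simp: recursive_fun_def)
  obtain c where c: "\<And>g xs. g \<in> set gs \<Longrightarrow> length xs = k \<Longrightarrow> computes (c g) xs (g xs)"
    using assms(2) unfolding recursive_fun_def by metis
  have "computes (Comp p (map c gs)) xs (f (map (\<lambda>g. g xs) gs))" if "length xs = k" for xs
    by (rule computes.comp[where ys = "map (\<lambda>g. g xs) gs"]) (use p c that in auto)
  then show ?thesis
    unfolding recursive_fun_def by blast
qed

lemma recursive_compose1:
  assumes "recursive_fun 1 (\<lambda>ys. F (ys ! 0))" "recursive_fun k f"
  shows "recursive_fun k (\<lambda>xs. F (f xs))"
  using recursive_compose[of "[f]" "\<lambda>ys. F (ys ! 0)" k] assms by simp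

lemma recursive_compose2:
  assumes "recursive_fun 2 (\<lambda>ys. F (ys ! 0) (ys ! 1))" "recursive_fun k f" "recursive_fun k g"
  shows "recursive_fun k (\<lambda>xs. F (f xs) (g xs))"
  using recursive_compose[of "[f, g]" "\<lambda>ys. F (ys ! 0) (ys ! 1)" k] assms
  by (auto simp: numeral_2_eq_2)

lemma recursive_Suc [recursive]:
  "recursive_fun k f \<Longrightarrow> recursive_fun k (\<lambda>xs. Suc (f xs))"
proof (rule recursive_compose1[where F = Suc])
  have "computes Succ xs (Suc (xs ! 0))" if "length xs = 1" for xs
    using that computes.succ by (cases xs) auto
  then show "recursive_fun 1 (\<lambda>ys. Suc (ys ! 0))"
    unfolding recursive_fun_def by blast
qed

lemma recursive_const [recursive]: "recursive_fun k (\<lambda>xs. c)"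
proof (induction c)
  case 0
  show ?case
    unfolding recursive_fun_def using computes.zero by blast
qed (rule recursive_Suc)

text \<open>Formulated for any \<open>h\<close> satisfying the recursion equations, so that the
  usual arithmetic operations can be inserted directly.\<close>

lemma recursive_prim_rec:
  assumes f: "recursive_fun k f" and g: "recursive_fun (Suc (Suc k)) g"
    and h: "\<And>xs. length xs = k \<Longrightarrow> h (0 # xs) = f xs"
      "\<And>n xs. length xs = k \<Longrightarrow> h (Suc n # xs) = g (n # h (n # xs) # xs)"
  shows "recursive_fun (Suc k) h"
proof -
  obtain p where p: "\<And>xs. length xs = k \<Longrightarrow> computes p xs (f xs)"
    using f by (auto simp: recursive_fun_def)
  obtain q where q: "\<And>xs. length xs = Suc (Suc k) \<Longrightarrow> computes q xs (g xs)"
    using g by (auto simp: recursive_fun_def)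
  have "computes (PrimRec p q) (n # xs) (h (n # xs))" if "length xs = k" for n xs
  proof (induction n)
    case 0
    then show ?case using that h(1) p by (auto intro: computes.prim_0)
  next
    case (Suc n)
    then show ?case using that h(2) q[of "n # h (n # xs) # xs"] by (auto intro: computes.prim_Suc)
  qed
  then have "\<forall>xs. length xs = Suc k \<longrightarrow> computes (PrimRec p q) xs (h xs)"
    by (auto simp: length_Suc_conv)
  then show ?thesis
    unfolding recursive_fun_def by blast
qed

section \<open>Arithmetic by primitive recursion\<close>

lemma recursive_add [recursive]:
  "recursive_fun k f \<Longrightarrow> recursive_fun k g \<Longrightarrow> recursive_fun k (\<lambda>xs. f xs + g xs)"
proof (rule recursive_compose2[where F = "(+)"])
  show "recursive_fun 2 (\<lambda>ys. ys ! 0 + ys ! 1)"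
    unfolding numeral_2_eq_2
    by (rule recursive_prim_rec[where f = "\<lambda>xs. xs ! 0" and g = "\<lambda>ys. Suc (ys ! 1)"])
      (auto intro: recursive)
qed

lemma recursive_mult [recursive]:
  "recursive_fun k f \<Longrightarrow> recursive_fun k g \<Longrightarrow> recursive_fun k (\<lambda>xs. f xs * g xs)"
proof (rule recursive_compose2[where F = "(*)"])
  show "recursive_fun 2 (\<lambda>ys. ys ! 0 * ys ! 1)"
    unfolding numeral_2_eq_2
    by (rule recursive_prim_rec[where f = "\<lambda>xs. 0" and g = "\<lambda>ys. ys ! Suc 1 + ys ! 1"])
      (auto intro: recursive)
qed

lemma recursive_power [recursive]:
  "recursive_fun k f \<Longrightarrow> recursive_fun k g \<Longrightarrow> recursive_fun k (\<lambda>xs. f xs ^ g xs)"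
\<comment> \<open>\<open>PrimRec\<close> recurses on the first argument, so the exponent is moved to
  the front. The subtrahend in \<open>recursive_diff\<close> is moved likewise.\<close>
proof (rule recursive_compose2[where F = "\<lambda>x y. y ^ x" and f = g and g = f])
  show "recursive_fun 2 (\<lambda>ys. (ys ! 1) ^ (ys ! 0))"
    unfolding numeral_2_eq_2
    by (rule recursive_prim_rec[where f = "\<lambda>xs. 1" and g = "\<lambda>ys. ys ! Suc 1 * ys ! 1"])
      (auto intro: recursive)
qed

lemma recursive_diff [recursive]:
  "recursive_fun k f \<Longrightarrow> recursive_fun k g \<Longrightarrow> recursive_fun k (\<lambda>xs. f xs - g xs)"
proof (rule recursive_compose2[where F = "\<lambda>x y. y - x" and f = g and g = f])
  \<comment> \<open>Truncated subtraction iterates the predecessor, which is the primitive recursion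
    that returns its own counter.\<close>
  have pred: "recursive_fun (Suc 0) (\<lambda>ys. ys ! 0 - 1)"
    by (rule recursive_prim_rec[where f = "\<lambda>xs. 0" and g = "\<lambda>ys. ys ! 0"]) (auto intro: recursive)
  have "recursive_fun 3 (\<lambda>xs. xs ! 1 - 1)"
    by (rule recursive_compose1[where F = "\<lambda>x. x - 1"]) (use pred in \<open>auto intro: recursive\<close>)
  then show "recursive_fun 2 (\<lambda>ys. ys ! 1 - ys ! 0)"
    unfolding numeral_2_eq_2 numeral_3_eq_3
    by (rule recursive_prim_rec[where f = "\<lambda>xs. xs ! 0", rotated]) (auto intro: recursive)
qed

section \<open>Comparisons, case distinction and Boolean combinations\<close>

lemma recursive_le [recursive]:
  assumes "recursive_fun k f" "recursive_fun k g"
  shows "recursive_rel k (\<lambda>xs. f xs \<le> g xs)"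
  unfolding recursive_rel_def
  \<comment> \<open>With truncated subtraction, \<open>1 - (1 - z)\<close> is 0 for z = 0 and 1
    otherwise, and \<open>f xs - g xs\<close> vanishes exactly when the comparison holds.\<close>
  by (rule recursive_fun_cong[where f = "\<lambda>xs. 1 - (1 - (f xs - g xs))"])
    (auto intro!: recursive assms)

lemma recursive_less [recursive]:
  "recursive_fun k f \<Longrightarrow> recursive_fun k g \<Longrightarrow> recursive_rel k (\<lambda>xs. f xs < g xs)"
  unfolding less_eq_Suc_le by (intro recursive)

lemma recursive_if [recursive]:
  assumes "recursive_rel k P" "recursive_fun k f" "recursive_fun k g"
  shows "recursive_fun k (\<lambda>xs. if P xs then f xs else g xs)"
proof -
  let ?c = "\<lambda>xs. if P xs then 0 else 1"
  \<comment> \<open>Both branches are total, so both can be evaluated and the unwanted one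
    multiplied by 0.\<close>
  have "recursive_fun k (\<lambda>xs. (1 - ?c xs) * f xs + ?c xs * g xs)"
    using assms unfolding recursive_rel_def by (intro recursive_add recursive_mult recursive_diff recursive_const)
  then show ?thesis
    by (rule recursive_fun_cong) auto
qed

lemma recursive_conj [recursive]:
  assumes "recursive_rel k P" "recursive_rel k Q"
  shows "recursive_rel k (\<lambda>xs. P xs \<and> Q xs)"
  unfolding recursive_rel_def
  by (rule recursive_fun_cong[where f = "\<lambda>xs. if P xs then if Q xs then 0 else 1 else 1"])
    (auto intro!: recursive assms)

lemma recursive_not [recursive]:
  assumes "recursive_rel k P"
  shows "recursive_rel k (\<lambda>xs. \<not> P xs)"
  unfolding recursive_rel_def
  by (rule recursive_fun_cong[where f = "\<lambda>xs. if P xs then 1 else 0"])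
    (auto intro!: recursive assms)

lemma recursive_disj [recursive]:
  assumes "recursive_rel k P" "recursive_rel k Q"
  shows "recursive_rel k (\<lambda>xs. P xs \<or> Q xs)"
  unfolding recursive_rel_def
  by (rule recursive_fun_cong[where f = "\<lambda>xs. if P xs then 0 else if Q xs then 0 else 1"])
    (auto intro!: recursive assms)

lemma recursive_eq [recursive]:
  "recursive_fun k f \<Longrightarrow> recursive_fun k g \<Longrightarrow> recursive_rel k (\<lambda>xs. f xs = g xs)"
  unfolding eq_iff by (intro recursive)

lemma recursive_rel_compose:
  assumes "recursive_rel (length gs) P" "\<And>g. g \<in> set gs \<Longrightarrow> recursive_fun k g"
  shows "recursive_rel k (\<lambda>xs. P (map (\<lambda>g. g xs) gs))"
  using recursive_compose[OF assms[unfolded recursive_rel_def]] unfolding recursive_rel_def .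

section \<open>Bounded quantifiers and unbounded search\<close>

text \<open>By primitive recursion on the bound: raising it by one adds a single candidate to
  test.\<close>

lemma recursive_bex [recursive]:
  assumes Q: "recursive_rel (Suc k) (\<lambda>ys. Q (hd ys) (tl ys))" and b: "recursive_fun k b"
  shows "recursive_rel k (\<lambda>xs. \<exists>i<b xs. Q i xs)"
proof -
  let ?P = "\<lambda>ys. Q (hd ys) (tl ys)"
  let ?h = "\<lambda>xs. if \<exists>i<hd xs. Q i (tl xs) then 0 else 1"
  \<comment> \<open>\<open>?gs\<close> drops the second argument, in which \<open>PrimRec\<close>
    passes the previous value; \<open>?bs\<close> puts the bound in front.\<close>
  let ?gs = "hd # map (\<lambda>i xs. xs ! (i + 2)) [0..<k]"
  let ?bs = "b # map (\<lambda>i xs. xs ! i) [0..<k]"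
  have gs: "map (\<lambda>g. g xs) ?gs = hd xs # tl (tl xs)" if "length xs = Suc (Suc k)" for xs :: "nat list"
    using that by (intro nth_equalityI) (auto simp: nth_Cons nth_tl split: nat.split)
  have bs: "map (\<lambda>g. g xs) ?bs = b xs # xs" if "length xs = k" for xs :: "nat list"
    using that by (intro nth_equalityI) (auto simp: nth_Cons split: nat.split)
  have "recursive_rel (Suc (Suc k)) (\<lambda>xs. ?P (map (\<lambda>g. g xs) ?gs))"
    by (rule recursive_rel_compose) (use Q in \<open>auto intro: recursive\<close>)
  then have "recursive_rel (Suc (Suc k)) (\<lambda>xs. Q (hd xs) (tl (tl xs)))"
    by (rule recursive_rel_cong) (simp only: gs list.sel)
  \<comment> \<open>\<open>hd (tl xs)\<close> is the value at the previous bound; it is 0 when a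
    witness has been found already.\<close>
  then have "recursive_rel (Suc (Suc k)) (\<lambda>xs. hd (tl xs) = 0 \<or> Q (hd xs) (tl (tl xs)))"
    by (intro recursive) auto
  then have "recursive_fun (Suc k) ?h"
    unfolding recursive_rel_def
    by (rule recursive_prim_rec[where f = "\<lambda>xs. 1", OF recursive_const]) (auto simp: less_Suc_eq)
  then have "recursive_fun k (\<lambda>xs. ?h (map (\<lambda>g. g xs) ?bs))"
    by (intro recursive_compose) (use b in \<open>auto intro: recursive\<close>)
  then show ?thesis
    unfolding recursive_rel_def by (rule recursive_fun_cong) (simp only: bs list.sel)
qed

lemma recursive_ball [recursive]:
  assumes "recursive_rel (Suc k) (\<lambda>ys. Q (hd ys) (tl ys))" "recursive_fun k b"
  shows "recursive_rel k (\<lambda>xs. \<forall>i<b xs. Q i xs)"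
proof -
  have "recursive_rel k (\<lambda>xs. \<not> (\<exists>i<b xs. \<not> Q i xs))"
    by (intro recursive_not recursive_bex assms)
  then show ?thesis
    by simp
qed

text \<open>The existence of a witness makes the search by \<open>Mu\<close> total, and the decision
  program returns 1, a successor, at every smaller candidate.\<close>

lemma recursive_Least:
  assumes Q: "recursive_rel (Suc k) (\<lambda>ys. Q (hd ys) (tl ys))"
    and ex: "\<And>xs. length xs = k \<Longrightarrow> \<exists>n. Q n xs"
  shows "recursive_fun k (\<lambda>xs. LEAST n. Q n xs)"
proof -
  obtain p where p: "\<And>xs. length xs = Suc k \<Longrightarrow> computes p xs (if Q (hd xs) (tl xs) then 0 else 1)"
    using Q by (auto simp: recursive_rel_def recursive_fun_def)
  have "computes (Mu p) xs (LEAST n. Q n xs)" if xs: "length xs = k" for xs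
  proof (rule computes.mu)
    show "computes p ((LEAST n. Q n xs) # xs) 0"
      using p[of "(LEAST n. Q n xs) # xs"] LeastI_ex[OF ex[OF xs]] xs by simp
    show "\<exists>j. computes p (m # xs) (Suc j)" if "m < (LEAST n. Q n xs)" for m
      using p[of "m # xs"] not_less_Least[OF that] xs by auto
  qed
  then show ?thesis
    unfolding recursive_fun_def by blast
qed

text \<open>\<open>Mu\<close> searches over a dummy first argument that the decision program
  ignores: the search stops at once if \<open>P\<close> holds and runs forever otherwise.\<close>

lemma recursive_rel_halts:
  assumes "recursive_rel k P"
  shows "\<exists>p. \<forall>xs. length xs = k \<longrightarrow> (halts p xs \<longleftrightarrow> P xs)"
proof -
  have "recursive_rel (Suc k) (\<lambda>ys. P (map (\<lambda>g. g ys) (map (\<lambda>i xs. xs ! Suc i) [0..<k])))"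
    by (rule recursive_rel_compose) (use assms in \<open>auto intro: recursive\<close>)
  moreover have "map (\<lambda>g. g (n # xs)) (map (\<lambda>i xs. xs ! Suc i) [0..<k]) = xs" if "length xs = k" for n and xs :: "nat list"
    using that by (auto simp: o_def map_nth intro: nth_equalityI)
  ultimately obtain p where p: "\<And>n xs. length xs = k \<Longrightarrow> computes p (n # xs) (if P xs then 0 else 1)"
    unfolding recursive_rel_def recursive_fun_def by (metis length_Cons)
  have "halts (Mu p) xs \<longleftrightarrow> P xs" if xs: "length xs = k" for xs
  proof
    assume "halts (Mu p) xs"
    then obtain n where "computes p (n # xs) 0"
      unfolding halts_def by (auto elim: computes.cases)
    then show "P xs"
      using computes_unique[OF p[OF xs]] by (metis zero_neq_one)
  next
    assume "P xs"
    then have "computes (Mu p) xs 0"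
      using p[OF xs, of 0] by (intro computes.mu) auto
    then show "halts (Mu p) xs"
      unfolding halts_def by blast
  qed
  then show ?thesis by blast
qed

section \<open>Division, pairing and coded finite sets\<close>

lemma recursive_div [recursive]:
  assumes "recursive_fun k f" "recursive_fun k g"
  shows "recursive_fun k (\<lambda>xs. f xs div g xs)"
proof (rule recursive_compose2[where F = "(div)", OF _ assms])
  \<comment> \<open>The disjunct \<open>y = 0\<close> keeps the search total and yields the
    convention \<open>x div 0 = 0\<close>.\<close>
  have "(LEAST q. y = 0 \<or> x < Suc q * y) = x div y" for x y :: nat
  proof (rule Least_equality)
    show "y = 0 \<or> x < Suc (x div y) * y"
      using dividend_less_div_times[of y x] by (cases "y = 0") auto
    show "x div y \<le> q" if "y = 0 \<or> x < Suc q * y" for q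
      using that by (cases "y = 0") (auto simp: less_mult_imp_div_less less_Suc_eq_le[symmetric])
  qed
  moreover have "recursive_fun 2 (\<lambda>ys. LEAST q. ys ! 1 = 0 \<or> ys ! 0 < Suc q * ys ! 1)"
  proof (rule recursive_Least)
    show "recursive_rel (Suc 2) (\<lambda>ys. tl ys ! 1 = 0 \<or> tl ys ! 0 < Suc (hd ys) * tl ys ! 1)"
      by (intro recursive) auto
    show "\<exists>q. ys ! 1 = 0 \<or> ys ! 0 < Suc q * ys ! 1" for ys :: "nat list"
      using dividend_less_div_times[of "ys ! 1" "ys ! 0"] by (intro exI[of _ "ys ! 0 div ys ! 1"]) auto
  qed
  ultimately show "recursive_fun 2 (\<lambda>ys. ys ! 0 div ys ! 1)"
    by simp
qed

lemma recursive_mod [recursive]: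
  "recursive_fun k f \<Longrightarrow> recursive_fun k g \<Longrightarrow> recursive_fun k (\<lambda>xs. f xs mod g xs)"
  unfolding modulo_nat_def by (intro recursive)

lemma recursive_min [recursive]:
  "recursive_fun k f \<Longrightarrow> recursive_fun k g \<Longrightarrow> recursive_fun k (\<lambda>xs. min (f xs) (g xs))"
  unfolding min_def by (intro recursive)

lemma recursive_prod_encode [recursive]:
  "recursive_fun k f \<Longrightarrow> recursive_fun k g \<Longrightarrow> recursive_fun k (\<lambda>xs. prod_encode (f xs, g xs))"
  unfolding prod_encode_def triangle_def split by (intro recursive)

text \<open>Decoding is a search for a component; the other one is at most the code of the pair, so
  its quantifier is bounded.\<close>

lemma recursive_fst_prod_decode [recursive]:
  assumes "recursive_fun k f"
  shows "recursive_fun k (\<lambda>xs. fst (prod_decode (f xs)))"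
proof (rule recursive_compose1[where F = "\<lambda>n. fst (prod_decode n)", OF _ assms])
  show "recursive_fun 1 (\<lambda>ys. fst (prod_decode (ys ! 0)))"
  proof (rule recursive_fun_cong[OF recursive_Least])
    show "recursive_rel (Suc 1) (\<lambda>ys. \<exists>b<Suc (tl ys ! 0). prod_encode (hd ys, b) = tl ys ! 0)"
      by (intro recursive) auto
    show *: "\<exists>a. \<exists>b<Suc (xs ! 0). prod_encode (a, b) = xs ! 0" for xs
      by (metis le_imp_less_Suc le_prod_encode_2 prod.collapse prod_decode_inverse)
    show "(LEAST a. \<exists>b<Suc (xs ! 0). prod_encode (a, b) = xs ! 0) = fst (prod_decode (xs ! 0))" for xs
      by (rule Least_equality; metis * fst_conv order_refl prod_encode_inverse)
  qed
qed

lemma recursive_snd_prod_decode [recursive]: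
  assumes "recursive_fun k f"
  shows "recursive_fun k (\<lambda>xs. snd (prod_decode (f xs)))"
proof (rule recursive_compose1[where F = "\<lambda>n. snd (prod_decode n)", OF _ assms])
  show "recursive_fun 1 (\<lambda>ys. snd (prod_decode (ys ! 0)))"
  proof (rule recursive_fun_cong[OF recursive_Least])
    show "recursive_rel (Suc 1) (\<lambda>ys. prod_encode (fst (prod_decode (tl ys ! 0)), hd ys) = tl ys ! 0)"
      by (intro recursive) auto
    show *: "\<exists>b. prod_encode (fst (prod_decode (xs ! 0)), b) = xs ! 0" for xs
      by (metis prod.collapse prod_decode_inverse)
    show "(LEAST b. prod_encode (fst (prod_decode (xs ! 0)), b) = xs ! 0) = snd (prod_decode (xs ! 0))" for xs
      by (rule Least_equality; metis * snd_conv order_refl prod_encode_inverse)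
  qed
qed

lemma recursive_mem_set_decode [recursive]:
  assumes "recursive_fun k f" "recursive_fun k g"
  shows "recursive_rel k (\<lambda>xs. f xs \<in> set_decode (g xs))"
  unfolding set_decode_def mem_Collect_eq odd_iff_mod_2_eq_one by (intro recursive assms)


section \<open>Systems of finite orbits converging to a fixed point\<close>

text \<open>
  A point records the inverse size of its orbit, which serves as its distance to the limit
  point, in coordinate \<open>0\<close>, and its position in the orbit in all other coordinates.
\<close>
definition orbit_point :: "nat \<Rightarrow> int \<Rightarrow> nat \<Rightarrow> real" where
  "orbit_point n t = (\<lambda>i. if i = 0 then 1 / real (n + 2) else real_of_int (t mod int (n + 2)))"

definition limit_point :: "nat \<Rightarrow> real" where
  "limit_point = (\<lambda>_. 0)"

definition orbits :: "nat set \<Rightarrow> (nat \<Rightarrow> real) set" where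
  "orbits A = insert limit_point {orbit_point n t |n t. n \<in> A}"

text \<open>An ultrametric on every \<open>orbits A\<close>. Distinct points of orbit
  \<open>n\<close> have distance 1/(n+2), which is also their distance to the limit point, so
  rotations are isometries and the orbits shrink to the limit point.\<close>

definition orbit_dist :: "(nat \<Rightarrow> real) \<Rightarrow> (nat \<Rightarrow> real) \<Rightarrow> real" where
  "orbit_dist u v = (if u = v then 0 else max \<bar>u 0\<bar> \<bar>v 0\<bar>)"

definition orbit_topology :: "nat set \<Rightarrow> (nat \<Rightarrow> real) topology" where
  "orbit_topology A = Metric_space.mtopology (orbits A) orbit_dist"

text \<open>Orbit size and position are recovered from the coordinates 0 and 1, so one formula
  serves all orbits and all \<open>A\<close>; the condition \<open>u 0 = 0\<close> singles out the
  limit point.\<close>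

definition rotation :: "int \<Rightarrow> (nat \<Rightarrow> real) \<Rightarrow> nat \<Rightarrow> real" where
  "rotation t u =
    (\<lambda>i. if i = 0 \<or> u 0 = 0 then u i else real_of_int ((\<lfloor>u 1\<rfloor> + t) mod \<lfloor>1 / u 0\<rfloor>))"

text \<open>The integers, encoded on the natural numbers by \<^const>\<open>int_encode\<close>.\<close>
definition int_group :: "nat monoid" where
  "int_group = \<lparr>carrier = UNIV, mult = (\<lambda>a b. int_encode (int_decode a + int_decode b)),
    one = int_encode 0\<rparr>"

text \<open>The elements of \<open>BijGroup\<close> are extensional functions, hence the
  restriction.\<close>

definition orbit_action :: "nat set \<Rightarrow> nat \<Rightarrow> (nat \<Rightarrow> real) \<Rightarrow> nat \<Rightarrow> real" where
  "orbit_action A g = restrict (rotation (int_decode g)) (orbits A)"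

lemma orbit_point_0 [simp]: "orbit_point n t 0 = 1 / real (n + 2)"
  by (simp add: orbit_point_def)

lemma limit_point_apply [simp]: "limit_point i = 0"
  by (simp add: limit_point_def)

lemma orbit_point_eq_iff:
  "orbit_point n t = orbit_point m t' \<longleftrightarrow> n = m \<and> t mod int (n + 2) = t' mod int (n + 2)"
proof
  assume eq: "orbit_point n t = orbit_point m t'"
  from fun_cong[OF eq, of 0] have "n = m"
    by simp
  moreover from fun_cong[OF eq, of 1] have "t mod int (n + 2) = t' mod int (m + 2)"
    by (simp add: orbit_point_def)
  ultimately show "n = m \<and> t mod int (n + 2) = t' mod int (n + 2)"
    by simp
next
  assume eq: "n = m \<and> t mod int (n + 2) = t' mod int (n + 2)"
  then have "m = n" "t' mod int (n + 2) = t mod int (n + 2)"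
    by metis+
  then show "orbit_point n t = orbit_point m t'"
    by (simp only: orbit_point_def)
qed

lemma orbit_point_neq_limit_point [simp]:
  "orbit_point n t \<noteq> limit_point" "limit_point \<noteq> orbit_point n t"
proof -
  show "orbit_point n t \<noteq> limit_point"
  proof
    assume "orbit_point n t = limit_point"
    then have "orbit_point n t 0 = limit_point 0"
      by simp
    then show False
      by (simp add: add_nonneg_eq_0_iff)
  qed
  then show "limit_point \<noteq> orbit_point n t"
    by simp
qed

lemma limit_point_in_orbits [simp]: "limit_point \<in> orbits A"
  by (simp add: orbits_def)

lemma orbit_point_in_orbits [simp]: "orbit_point n t \<in> orbits A \<longleftrightarrow> n \<in> A"
  by (auto simp: orbits_def orbit_point_eq_iff)

lemma orbits_cases:
  assumes "u \<in> orbits A"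
  obtains "u = limit_point" | n t where "n \<in> A" "u = orbit_point n t"
  using assms by (auto simp: orbits_def)

lemma orbits_nonneg: "u \<in> orbits A \<Longrightarrow> 0 \<le> u 0"
  by (elim orbits_cases) auto

lemma orbits_pos: "u \<in> orbits A \<Longrightarrow> u \<noteq> limit_point \<Longrightarrow> 0 < u 0"
  by (elim orbits_cases) auto

section \<open>Metric and compactness of the orbit spaces\<close>

lemma Metric_space_orbits: "Metric_space (orbits A) orbit_dist"
proof
  fix u v w
  show "0 \<le> orbit_dist u v"
    by (simp add: orbit_dist_def le_max_iff_disj)
  show "orbit_dist u v = orbit_dist v u"
    by (simp add: orbit_dist_def max.commute)
  show "orbit_dist u v = 0 \<longleftrightarrow> u = v" if "u \<in> orbits A" "v \<in> orbits A"
    using orbits_pos[OF that(1)] orbits_pos[OF that(2)] orbits_nonneg[OF that(1)] orbits_nonneg[OF that(2)]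
    by (cases "u = limit_point"; cases "v = limit_point") (auto simp: orbit_dist_def max_def)
  show "orbit_dist u w \<le> orbit_dist u v + orbit_dist v w"
    if "u \<in> orbits A" "v \<in> orbits A" "w \<in> orbits A"
    using that[THEN orbits_nonneg] by (auto simp: orbit_dist_def)
qed

interpretation orbits: Metric_space "orbits A" orbit_dist for A
  by (rule Metric_space_orbits)

lemma topspace_orbit_topology [simp]: "topspace (orbit_topology A) = orbits A"
  by (simp add: orbit_topology_def)

lemma metrizable_space_orbit_topology: "metrizable_space (orbit_topology A)"
  by (simp add: orbit_topology_def orbits.metrizable_space_mtopology)

text \<open>Meant for the rotations and for the collapse of orbits, none of which increases
  distances.\<close>

lemma continuous_map_orbit_topology:
  assumes "f ` orbits A \<subseteq> orbits B"
    and "\<And>u v. u \<in> orbits A \<Longrightarrow> v \<in> orbits A \<Longrightarrow> orbit_dist (f u) (f v) \<le> orbit_dist u v"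
  shows "continuous_map (orbit_topology A) (orbit_topology B) f"
  unfolding orbit_topology_def orbits.metric_continuous_map[OF Metric_space_orbits]
  using assms by (meson order_le_less_trans)

lemma finite_orbit_points: "finite {orbit_point n t |n t. n < N}"
proof -
  have "orbit_point n t = orbit_point n (t mod int (n + 2))" for n t
    by (simp add: orbit_point_eq_iff)
  then have "{orbit_point n t |n t. n < N} \<subseteq> (\<Union>n<N. orbit_point n ` {0..<int (n + 2)})"
    by (force simp del: of_nat_add)
  then show ?thesis
    by (rule finite_subset) auto
qed

text \<open>A member of the cover that contains the limit point contains all orbits of large index
  and so misses only finitely many points.\<close>

lemma compact_space_orbit_topology: "compact_space (orbit_topology A)"
  unfolding compact_space_def compactin_def
proof (intro conjI allI impI; (elim conjE)?)
  fix \<U> assume op: "\<forall>U\<in>\<U>. openin (orbit_topology A) U"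
    and cover: "topspace (orbit_topology A) \<subseteq> \<Union> \<U>"
  then obtain U where U: "U \<in> \<U>" "limit_point \<in> U"
    using limit_point_in_orbits by (metis UnionE subsetD topspace_orbit_topology)
  then obtain r where r: "0 < r" "orbits.mball A limit_point r \<subseteq> U"
    using op by (metis orbit_topology_def orbits.openin_mtopology)
  obtain N where N: "inverse (real (Suc N)) < r"
    using r(1) reals_Archimedean by blast
  have sub: "orbits A - U \<subseteq> {orbit_point n t |n t. n < N}"
  proof
    fix u assume u: "u \<in> orbits A - U"
    then obtain n t where nt: "n \<in> A" "u = orbit_point n t"
      using U by (auto elim: orbits_cases)
    have "r \<le> orbit_dist limit_point u"
      using u r(2) by (force simp: orbits.in_mball)
    then have "r \<le> 1 / real (n + 2)"
      by (simp add: orbit_dist_def nt)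
    then have "inverse (real (Suc N)) < inverse (real (n + 2))"
      using N by (simp add: inverse_eq_divide)
    then have "n < N"
      by (simp add: inverse_less_iff_less)
    then show "u \<in> {orbit_point n t |n t. n < N}"
      using nt by blast
  qed
  then have "finite (orbits A - U)"
    using finite_orbit_points finite_subset by blast
  moreover have "orbits A - U \<subseteq> \<Union> \<U>"
    using cover by auto
  ultimately obtain \<F> where "finite \<F>" "\<F> \<subseteq> \<U>" "orbits A - U \<subseteq> \<Union> \<F>"
    by (rule finite_subset_Union)
  then show "\<exists>\<F>. finite \<F> \<and> \<F> \<subseteq> \<U> \<and> topspace (orbit_topology A) \<subseteq> \<Union> \<F>"
    using U by (intro exI[of _ "insert U \<F>"]) auto
qed simp

section \<open>Rotations and the action of the integers\<close>

lemma rotation_limit_point [simp]: "rotation t limit_point = limit_point"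
  by (simp add: rotation_def limit_point_def)

lemma rotation_orbit_point [simp]: "rotation t (orbit_point n k) = orbit_point n (k + t)"
proof
  fix i
  have "\<lfloor>1 / (1 / real (n + 2))\<rfloor> = int (n + 2)"
    by simp
  then show "rotation t (orbit_point n k) i = orbit_point n (k + t) i"
    by (simp add: rotation_def orbit_point_def mod_add_left_eq)
qed

lemma rotation_in_orbits: "u \<in> orbits A \<Longrightarrow> rotation t u \<in> orbits A"
  by (elim orbits_cases) auto

lemma rotation_rotation: "u \<in> orbits A \<Longrightarrow> rotation a (rotation b u) = rotation (a + b) u"
  by (elim orbits_cases) (auto simp: ac_simps)

lemma rotation_0: "u \<in> orbits A \<Longrightarrow> rotation 0 u = u"
  by (elim orbits_cases) auto

lemma rotation_fixes_orbit_point: "rotation t (orbit_point n k) = orbit_point n k \<longleftrightarrow> int n + 2 dvd t"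
  by (simp add: orbit_point_eq_iff mod_eq_dvd_iff add.commute)

text \<open>Rotations are injective and leave coordinate 0 alone, and \<open>orbit_dist\<close>
  depends only on that coordinate and on equality.\<close>

lemma orbit_dist_rotation:
  assumes "u \<in> orbits A" "v \<in> orbits A"
  shows "orbit_dist (rotation t u) (rotation t v) = orbit_dist u v"
proof -
  have "rotation t u = rotation t v \<Longrightarrow> u = v"
    using assms rotation_rotation[of _ A "- t" t] rotation_0 by (metis add.left_inverse)
  moreover have "rotation t w 0 = w 0" for w
    by (simp add: rotation_def)
  ultimately show ?thesis
    by (auto simp: orbit_dist_def)
qed

lemma group_int_group: "group int_group"
proof (rule groupI)
  show "\<exists>b\<in>carrier int_group. b \<otimes>\<^bsub>int_group\<^esub> a = \<one>\<^bsub>int_group\<^esub>" for a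
    by (rule bexI[of _ "int_encode (- int_decode a)"]) (auto simp: int_group_def)
qed (auto simp: int_group_def add.assoc)

lemma generating_set_int_group: "generating_set int_group {int_encode 1}"
proof -
  interpret group int_group by (rule group_int_group)
  let ?H = "generate int_group {int_encode 1}"
  have sub: "subgroup ?H int_group"
    by (rule generate_is_subgroup) (simp add: int_group_def)
  have nat: "int_encode (int n) \<in> ?H" for n
  proof (induction n)
    case 0
    show ?case
      using generate.one[of int_group] by (simp add: int_group_def)
  next
    case (Suc n)
    have "int_encode (int n) \<otimes>\<^bsub>int_group\<^esub> int_encode 1 \<in> ?H"
      by (rule generate.eng[OF Suc.IH]) (simp add: generate.incl)
    then show ?case
      by (simp add: int_group_def add.commute)
  qed
  have neg: "int_encode (- int n) \<in> ?H" for n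
  proof -
    have "inv\<^bsub>int_group\<^esub> int_encode (int n) = int_encode (- int n)"
      by (rule inv_equality) (auto simp: int_group_def)
    then show ?thesis
      using subgroup.m_inv_closed[OF sub nat[of n]] by metis
  qed
  have "g \<in> ?H" for g
    using nat[of "nat (int_decode g)"] neg[of "nat (- int_decode g)"]
    by (cases "0 \<le> int_decode g") auto
  then show ?thesis
    by (auto simp: generating_set_def int_group_def)
qed

lemma finitely_generated_int_group: "finitely_generated int_group"
  unfolding finitely_generated_def using group_int_group generating_set_int_group by blast

lemma orbit_action_eq [simp]: "u \<in> orbits A \<Longrightarrow> orbit_action A g u = rotation (int_decode g) u"
  by (simp add: orbit_action_def)

lemma homeomorphic_map_orbit_action:
  "homeomorphic_map (orbit_topology A) (orbit_topology A) (orbit_action A g)"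
proof -
  have cont: "continuous_map (orbit_topology A) (orbit_topology A) (rotation t)" for t
    by (rule continuous_map_orbit_topology) (auto simp: rotation_in_orbits orbit_dist_rotation)
  have "homeomorphic_maps (orbit_topology A) (orbit_topology A)
      (rotation (int_decode g)) (rotation (- int_decode g))"
    unfolding homeomorphic_maps_def using cont by (auto simp: rotation_rotation rotation_0)
  then have "homeomorphic_map (orbit_topology A) (orbit_topology A) (rotation (int_decode g))"
    using homeomorphic_maps_map by blast
  then show ?thesis
    by (rule homeomorphic_map_eq) simp
qed

lemma topological_action_orbit_action:
  "topological_action int_group (orbit_topology A) (orbit_action A)"
proof -
  have "orbit_action A g \<in> Bij (orbits A)" for g
    using homeomorphic_imp_injective_map[OF homeomorphic_map_orbit_action]
      homeomorphic_imp_surjective_map[OF homeomorphic_map_orbit_action]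
    by (auto simp: Bij_def bij_betw_def) (simp add: orbit_action_def)
  moreover have "orbit_action A (a \<otimes>\<^bsub>int_group\<^esub> b) =
      compose (orbits A) (orbit_action A a) (orbit_action A b)" for a b
    by (rule ext) (auto simp: orbit_action_def compose_def int_group_def rotation_rotation rotation_in_orbits)
  ultimately have "group_hom int_group (BijGroup (orbits A)) (orbit_action A)"
    using group_int_group group_BijGroup[of "orbits A"]
    by (auto simp: group_hom_def group_hom_axioms_def hom_def BijGroup_def)
  then show ?thesis
    by (simp add: topological_action_def group_action_def homeomorphic_map_orbit_action)
qed

text \<open>Sending a point to the limit point lowers its coordinate 0 to 0, so distances do not
  grow. The map is equivariant because whole orbits are collapsed to a fixed point.\<close>

lemma topological_factor_map_orbits:
  assumes "A \<subseteq> B"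
  shows "topological_factor_map int_group (orbit_topology B) (orbit_action B)
    (orbit_topology A) (orbit_action A) (\<lambda>u. if u \<in> orbits A then u else limit_point)"
    (is "topological_factor_map _ _ _ _ _ ?f")
  unfolding topological_factor_map_def
proof (intro conjI ballI)
  have sub: "orbits A \<subseteq> orbits B"
    using assms by (auto simp: orbits_def)
  show "continuous_map (orbit_topology B) (orbit_topology A) ?f"
    by (rule continuous_map_orbit_topology) (auto simp: orbit_dist_def dest: orbits_nonneg)
  show "?f ` topspace (orbit_topology B) = topspace (orbit_topology A)"
    using sub by force
  fix g u assume "u \<in> topspace (orbit_topology B)"
  then have "u \<in> orbits B"
    by simp
  then show "?f (orbit_action B g u) = orbit_action A g (?f u)"
    by (cases rule: orbits_cases) auto
qed


section \<open>Computability of the system of all orbits\<close>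

abbreviation (input) "pfst n \<equiv> fst (prod_decode n)"
abbreviation (input) "psnd n \<equiv> snd (prod_decode n)"

text \<open>The sequence passes through all orbit points and reaches the limit point only in the
  closure. Positions are not reduced modulo the orbit size, so points repeat and
  \<open>same_code\<close> decides equality.\<close>

definition orbit_seq :: "nat \<Rightarrow> nat \<Rightarrow> real" where
  "orbit_seq i = orbit_point (pfst i) (int (psnd i))"

definition same_code :: "nat \<Rightarrow> nat \<Rightarrow> bool" where
  "same_code i l \<longleftrightarrow> pfst i = pfst l \<and> psnd i mod (pfst i + 2) = psnd l mod (pfst i + 2)"

text \<open>\<open>rat_decode\<close> adds 1 to the coded denominator, so the second case stands for
  1/(min + 2).\<close>

definition dist_code :: "nat \<Rightarrow> nat \<Rightarrow> nat" where
  "dist_code i l = (if same_code i l then prod_encode (int_encode 0, 0)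
    else prod_encode (int_encode 1, Suc (min (pfst i) (pfst l))))"

text \<open>For \<open>m\<close> coding ((n, k), (a, b)) the ball has its centre in orbit
  \<open>n\<close> and radius (a+1)/(b+1); the inequality is 1/(n+2) < (a+1)/(b+1) with denominators
  cleared. \<open>seq_in_ball\<close> treats its second case in the same way.\<close>

definition limit_in_ball :: "nat \<Rightarrow> bool" where
  "limit_in_ball m \<longleftrightarrow> Suc (psnd (psnd m)) < Suc (pfst (psnd m)) * (pfst (pfst m) + 2)"

definition seq_in_ball :: "nat \<Rightarrow> nat \<Rightarrow> bool" where
  "seq_in_ball l m \<longleftrightarrow> same_code (pfst m) l \<or>
    Suc (psnd (psnd m)) < Suc (pfst (psnd m)) * (min (pfst (pfst m)) (pfst l) + 2)"

text \<open>
  The bound \<open>e\<close> suffices: if the ball coded by \<open>m < e\<close> contains the limit point, then it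
  contains all orbits whose index is at least the code of the denominator of its radius, and
  this code is at most \<open>m\<close>.
\<close>
definition covers_orbits :: "nat \<Rightarrow> bool" where
  "covers_orbits e \<longleftrightarrow> (\<exists>m<e. m \<in> set_decode e \<and> limit_in_ball m) \<and>
    (\<forall>n<e. \<forall>k<Suc e. \<exists>m<e. m \<in> set_decode e \<and> seq_in_ball (prod_encode (n, k)) m)"

section \<open>Arithmetic description of distances and balls\<close>

lemma orbit_seq_eq_iff: "orbit_seq i = orbit_seq l \<longleftrightarrow> same_code i l"
  unfolding orbit_seq_def same_code_def orbit_point_eq_iff by (metis of_nat_eq_iff zmod_int)

lemma orbit_seq_in_orbits [simp]: "orbit_seq i \<in> orbits UNIV"
  by (simp add: orbit_seq_def)

lemma orbit_dist_orbit_seq: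
  "orbit_dist (orbit_seq i) (orbit_seq l) =
    (if same_code i l then 0 else 1 / real (min (pfst i) (pfst l) + 2))"
proof -
  have "max (1 / (2 + real a)) (1 / (2 + real b)) = 1 / (2 + real (min a b))" for a b
  proof (cases "a \<le> b")
    case True
    then have "1 / (2 + real b) \<le> 1 / (2 + real a)"
      by (simp add: frac_le)
    then show ?thesis
      using True by simp
  next
    case False
    then have "1 / (2 + real a) \<le> 1 / (2 + real b)"
      by (simp add: frac_le)
    then show ?thesis
      using False by simp
  qed
  then show ?thesis
    unfolding orbit_dist_def orbit_seq_eq_iff by (simp add: orbit_seq_def)
qed

lemma orbit_dist_orbit_seq_limit_point:
  "orbit_dist (orbit_seq i) limit_point = 1 / real (pfst i + 2)"
  by (simp add: orbit_dist_def orbit_seq_def)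

lemma of_rat_dist_code:
  "of_rat (rat_decode (dist_code i l)) = orbit_dist (orbit_seq i) (orbit_seq l)"
  by (simp add: orbit_dist_orbit_seq dist_code_def rat_decode_def of_rat_rat)

lemma less_pos_rat_decode_iff:
  "1 / real (k + 2) < of_rat (pos_rat_decode j) \<longleftrightarrow> Suc (psnd j) < Suc (pfst j) * (k + 2)"
proof -
  have "1 / real (k + 2) < of_rat (pos_rat_decode j) \<longleftrightarrow>
      real (Suc (psnd j)) < real (Suc (pfst j)) * real (k + 2)"
    by (simp add: pos_rat_decode_def of_rat_rat split_beta field_simps del: of_nat_Suc of_nat_add)
  then show ?thesis
    by (simp only: of_nat_mult[symmetric] of_nat_less_iff)
qed

lemma pos_rat_decode_pos: "0 < pos_rat_decode j"
  using range_pos_rat_decode by blast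

abbreviation "orbit_ball \<equiv> basic_ball (orbits UNIV) orbit_dist orbit_seq"

lemma in_orbit_ball_iff:
  "u \<in> orbit_ball m \<longleftrightarrow>
    u \<in> orbits UNIV \<and> orbit_dist (orbit_seq (pfst m)) u < of_rat (pos_rat_decode (psnd m))"
  by (simp add: basic_ball_def split_beta orbits.in_mball)

lemma limit_point_in_orbit_ball: "limit_point \<in> orbit_ball m \<longleftrightarrow> limit_in_ball m"
  unfolding in_orbit_ball_iff orbit_dist_orbit_seq_limit_point less_pos_rat_decode_iff limit_in_ball_def
  by simp

lemma orbit_seq_in_orbit_ball: "orbit_seq l \<in> orbit_ball m \<longleftrightarrow> seq_in_ball l m"
  unfolding in_orbit_ball_iff orbit_dist_orbit_seq seq_in_ball_def less_pos_rat_decode_iff[symmetric]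
  by (simp add: pos_rat_decode_pos)

section \<open>Computability of distance, compactness and action\<close>

lemma computable_metric_space_orbits: "computable_metric_space (orbits UNIV) orbit_dist orbit_seq"
proof
  show "range orbit_seq \<subseteq> orbits UNIV"
    by auto
  have ex: "\<exists>l. orbit_dist u (orbit_seq l) < r" if u: "u \<in> orbits UNIV" and r: "0 < r" for u r
    using u
  proof (cases rule: orbits_cases)
    case 1
    obtain n where "inverse (real (Suc n)) < r"
      using r reals_Archimedean by blast
    moreover have "1 / real (n + 2) \<le> inverse (real (Suc n))"
      by (simp add: inverse_eq_divide frac_le)
    ultimately have "orbit_dist u (orbit_seq (prod_encode (n, 0))) < r"
      unfolding 1 orbits.commute[of limit_point] orbit_dist_orbit_seq_limit_point by simp
    then show ?thesis ..
  next
    case (2 n t)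
    then have "u = orbit_seq (prod_encode (n, nat (t mod int (n + 2))))"
      by (simp add: orbit_seq_def orbit_point_eq_iff)
    then show ?thesis
      using r by (metis orbit_dist_def)
  qed
  show "orbits.mtopology UNIV closure_of (range orbit_seq) = orbits UNIV"
    unfolding orbits.metric_closure_of using ex by (fastforce simp: orbits.in_mball)
  \<comment> \<open>All distances between points of the sequence are rational and are returned
    exactly, whatever the requested precision.\<close>
  have "recursive_fun 3 (\<lambda>xs. dist_code (xs ! 0) (xs ! 1))"
    unfolding dist_code_def same_code_def by (intro recursive) auto
  then obtain p where p: "\<And>xs. length xs = 3 \<Longrightarrow> computes p xs (dist_code (xs ! 0) (xs ! 1))"
    by (auto simp: recursive_fun_def)
  show "\<exists>p. \<forall>i j n. \<exists>c. computes p [i, j, n] c \<and>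
      \<bar>orbit_dist (orbit_seq i) (orbit_seq j) - of_rat (rat_decode c)\<bar> \<le> 1 / 2 ^ n"
  proof (intro exI allI conjI)
    show "computes p [i, j, n] (dist_code i j)" for i j n
      using p[of "[i, j, n]"] by simp
  qed (simp add: of_rat_dist_code)
qed

text \<open>Bit \<open>m\<close> of \<open>e\<close> can only be set if 2^m is at most
  \<open>e\<close>; this turns quantifiers over a coded set into bounded ones.\<close>

lemma mem_set_decode_less: "m \<in> set_decode e \<Longrightarrow> m < e"
proof -
  assume "m \<in> set_decode e"
  then have "odd (e div 2 ^ m)"
    by (simp add: set_decode_def)
  then have "2 ^ m \<le> e"
    by (metis div_less even_zero not_le)
  moreover have "m < 2 ^ m"
    by simp
  ultimately show "m < e"
    by linarith
qed

lemma orbits_subset_iff_covers_orbits: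
  "orbits UNIV \<subseteq> (\<Union>m\<in>set_decode e. orbit_ball m) \<longleftrightarrow> covers_orbits e"
proof
  assume cover: "orbits UNIV \<subseteq> (\<Union>m\<in>set_decode e. orbit_ball m)"
  have "\<exists>m<e. m \<in> set_decode e \<and> limit_in_ball m"
    using cover limit_point_in_orbits[of UNIV] mem_set_decode_less
    unfolding limit_point_in_orbit_ball[symmetric] by blast
  moreover have "\<exists>m<e. m \<in> set_decode e \<and> seq_in_ball l m" for l
    using cover orbit_seq_in_orbits[of l] mem_set_decode_less
    unfolding orbit_seq_in_orbit_ball[symmetric] by blast
  ultimately show "covers_orbits e"
    by (simp add: covers_orbits_def)
next
  assume c: "covers_orbits e"
  then obtain m where m: "m < e" "m \<in> set_decode e" "limit_in_ball m"
    by (auto simp: covers_orbits_def)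
  have le: "psnd (psnd m) \<le> m"
    by (metis le_prod_encode_2 le_trans prod.collapse prod_decode_inverse)
  show "orbits UNIV \<subseteq> (\<Union>m\<in>set_decode e. orbit_ball m)"
  proof
    fix u :: "nat \<Rightarrow> real" assume "u \<in> orbits UNIV"
    then show "u \<in> (\<Union>m\<in>set_decode e. orbit_ball m)"
    proof (cases rule: orbits_cases)
      case 1
      then show ?thesis
        using m limit_point_in_orbit_ball by blast
    next
      case (2 n t)
      define k where "k = nat (t mod int (n + 2))"
      have u: "u = orbit_seq (prod_encode (n, k))"
        using 2 by (simp add: orbit_seq_def orbit_point_eq_iff k_def)
      have "k < n + 2"
        unfolding k_def by (simp add: nat_less_iff)
      show ?thesis
      proof (cases "n < e")
        case True
        \<comment> \<open>From n < e and k < n + 2; hence the bound \<open>Suc e\<close> on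
          positions in \<open>covers_orbits\<close>.\<close>
        then have "k < Suc e"
          using \<open>k < n + 2\<close> by simp
        then obtain m' where "m' \<in> set_decode e" "seq_in_ball (prod_encode (n, k)) m'"
          using c True unfolding covers_orbits_def by blast
        then show ?thesis
          using u orbit_seq_in_orbit_ball by blast
      next
        case False
        \<comment> \<open>The denominator code is at most m < e, and e is at most n, so 1/(n+2) is
          below the radius of ball \<open>m\<close> even if its numerator is 1. If the minimum in
          \<open>seq_in_ball\<close> is the index of the centre, \<open>limit_in_ball m\<close>
          gives the inequality.\<close>
        have "Suc (psnd (psnd m)) < 1 * (n + 2)"
          using False le m(1) by simp
        also have "\<dots> \<le> Suc (pfst (psnd m)) * (n + 2)"
          by (intro mult_right_mono) auto
        finally have "seq_in_ball (prod_encode (n, k)) m"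
          using m(3) by (auto simp: seq_in_ball_def limit_in_ball_def min_def)
        then show ?thesis
          using u m(2) orbit_seq_in_orbit_ball by blast
      qed
    qed
  qed
qed

text \<open>Covering amounts to the bounded arithmetic condition \<open>covers_orbits\<close> on the
  code of the finite set, so it is even decidable.\<close>

lemma recursively_compact_orbits:
  "recursively_compact (orbits UNIV) orbit_dist orbit_seq (orbits UNIV)"
proof -
  have "compactin (orbits.mtopology UNIV) (orbits UNIV)"
    using compact_space_orbit_topology[of UNIV] by (simp add: compact_space_def orbit_topology_def)
  moreover have "recursive_rel 1 (\<lambda>xs. covers_orbits (xs ! 0))"
    unfolding covers_orbits_def limit_in_ball_def seq_in_ball_def same_code_def
    by (intro recursive) auto
  then obtain p where p: "\<And>xs. length xs = 1 \<Longrightarrow> halts p xs \<longleftrightarrow> covers_orbits (xs ! 0)"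
    using recursive_rel_halts by blast
  have "halts p [set_encode I] \<longleftrightarrow> orbits UNIV \<subseteq> (\<Union>n\<in>I. orbit_ball n)" if "finite I" for I
    using p[of "[set_encode I]"] orbits_subset_iff_covers_orbits[of "set_encode I"] that by simp
  ultimately show ?thesis
    unfolding recursively_compact_def by blast
qed

text \<open>Under an isometric bijection the preimage of a ball is the ball of the same radius about
  the preimage of the centre, so a single index is enumerated.\<close>

lemma computable_map_orbit_action:
  "computable_map (orbits UNIV) orbit_dist orbit_seq (orbits UNIV) (orbits UNIV) orbit_dist orbit_seq
    (orbit_action UNIV (int_encode 1))"
proof -
  \<comment> \<open>The centre is moved by \<open>n + 1\<close>, which is \<open>- 1\<close> modulo the orbit size \<open>n + 2\<close>.\<close>
  let ?c = "\<lambda>m. prod_encode (prod_encode (pfst (pfst m), psnd (pfst m) + pfst (pfst m) + 1), psnd m)"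
  have "recursive_fun 2 (\<lambda>xs. ?c (xs ! 0))"
    by (intro recursive) auto
  then obtain p where p: "\<And>xs. length xs = 2 \<Longrightarrow> computes p xs (?c (xs ! 0))"
    unfolding recursive_fun_def by blast
  have enum: "enumerated p m = {?c m}" for m
    using p[of "[m, _]"] computes_unique unfolding enumerated_def by fastforce
  have centre: "rotation 1 (orbit_seq (pfst (?c m))) = orbit_seq (pfst m)" for m
    by (simp add: orbit_seq_def orbit_point_eq_iff) (metis add.assoc add.commute mod_add_self2)
  have "{u \<in> orbits UNIV. orbit_action UNIV (int_encode 1) u \<in> orbit_ball m} =
      (\<Union>n\<in>enumerated p m. orbit_ball n) \<inter> orbits UNIV" for m
  proof -
    have "orbit_dist (orbit_seq (pfst m)) (rotation 1 u) = orbit_dist (orbit_seq (pfst (?c m))) u"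
      if "u \<in> orbits UNIV" for u
      using orbit_dist_rotation[OF orbit_seq_in_orbits that] centre by metis
    then show ?thesis
      unfolding enum by (auto simp: in_orbit_ball_iff rotation_in_orbits)
  qed
  then show ?thesis
    unfolding computable_map_def by (auto simp: rotation_in_orbits)
qed

lemma effective_dynamical_system_orbits:
  "effective_dynamical_system int_group (orbit_topology UNIV) (orbit_action UNIV)"
proof -
  have top: "subtopology (orbits.mtopology UNIV) (orbits UNIV) = orbit_topology UNIV"
    using subtopology_topspace[of "orbit_topology UNIV"] by (simp add: orbit_topology_def)
  show ?thesis
  proof (rule effective_dynamical_systemI)
    show "computable_action int_group (orbits UNIV) orbit_dist orbit_seq (orbits UNIV) (orbit_action UNIV)"
      unfolding computable_action_def top
      using computable_metric_space_orbits recursively_compact_orbits topological_action_orbit_action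
        generating_set_int_group computable_map_orbit_action by blast
    show "topological_conjugacy int_group (orbit_topology UNIV) (orbit_action UNIV)
        (subtopology (orbits.mtopology UNIV) (orbits UNIV)) (orbit_action UNIV) id"
      unfolding top topological_conjugacy_def topological_factor_map_def
      by (auto intro: homeomorphic_map_id[THEN iffD2])
  qed (simp_all add: finitely_generated_int_group compact_space_orbit_topology
      metrizable_space_orbit_topology topological_action_orbit_action)
qed


section \<open>Countability of effective dynamical systems\<close>

instance recf :: countable
  by countable_datatype

text \<open>The witnesses hidden in \<open>computable_action\<close> become explicit, so that two
  systems sharing all of them can be compared. For a countable group there are only countably many
  codes.\<close>

definition coded_action ::
  "recf \<times> recf \<times> ('g \<times> recf) list \<Rightarrow> ('g, 'm) monoid_scheme \<Rightarrow>
   'a set \<Rightarrow> ('a \<Rightarrow> 'a \<Rightarrow> real) \<Rightarrow> (nat \<Rightarrow> 'a) \<Rightarrow> 'a set \<Rightarrow> ('g \<Rightarrow> 'a \<Rightarrow> 'a) \<Rightarrow> bool" where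
  "coded_action c G M d s K \<psi> \<longleftrightarrow>
    (case c of (p, q, L) \<Rightarrow>
      computable_metric_space M d s \<and> compactin (Metric_space.mtopology M d) K \<and>
      group_action G K \<psi> \<and> generating_set G (fst ` set L) \<and>
      (\<forall>i j n. \<exists>r. computes p [i, j, n] r \<and> \<bar>d (s i) (s j) - of_rat (rat_decode r)\<bar> \<le> 1 / 2 ^ n) \<and>
      (\<forall>I. finite I \<longrightarrow> (halts q [set_encode I] \<longleftrightarrow> K \<subseteq> (\<Union>n\<in>I. basic_ball M d s n))) \<and>
      (\<forall>(g, e) \<in> set L. \<forall>m. {y \<in> K. \<psi> g y \<in> basic_ball M d s m} =
        (\<Union>n\<in>enumerated e m. basic_ball M d s n) \<inter> K))"

lemma computable_action_coded:
  assumes "computable_action G M d s K \<psi>"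
  shows "\<exists>c. coded_action c G M d s K \<psi>"
proof -
  have cms: "computable_metric_space M d s" and rc: "recursively_compact M d s K"
    and ta: "topological_action G (subtopology (Metric_space.mtopology M d) K) \<psi>"
    using assms by (auto simp: computable_action_def)
  interpret computable_metric_space M d s
    by (rule cms)
  have "K \<subseteq> M"
    using rc compactin_subset_topspace by (fastforce simp: recursively_compact_def)
  then have act: "group_action G K \<psi>"
    using ta by (simp add: topological_action_def Int_absorb1)
  obtain p where p: "\<And>i j n. \<exists>r. computes p [i, j, n] r \<and>
      \<bar>d (s i) (s j) - of_rat (rat_decode r)\<bar> \<le> 1 / 2 ^ n"
    using computable_dist by blast
  obtain q where q: "\<And>I. finite I \<Longrightarrow> halts q [set_encode I] \<longleftrightarrow> K \<subseteq> (\<Union>n\<in>I. basic_ball M d s n)"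
    using rc by (auto simp: recursively_compact_def)
  obtain S where S: "finite S" "generating_set G S" "\<And>g. g \<in> S \<Longrightarrow> computable_map M d s K M d s (\<psi> g)"
    using assms by (auto simp: computable_action_def)
  then obtain e where e: "\<And>g m. g \<in> S \<Longrightarrow> {y \<in> K. \<psi> g y \<in> basic_ball M d s m} =
      (\<Union>n\<in>enumerated (e g) m. basic_ball M d s n) \<inter> K"
    unfolding computable_map_def by metis
  obtain xs where "set xs = S"
    using S(1) finite_list by blast
  then have "coded_action (p, q, map (\<lambda>g. (g, e g)) xs) G M d s K \<psi>"
    using rc cms act p q S(2) e
    by (auto simp: coded_action_def recursively_compact_def image_image)
  then show ?thesis ..
qed

section \<open>Points and the basic balls that contain them\<close>

lemma (in computable_metric_space) s_in: "s i \<in> M"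
  using range_s by blast

lemma (in computable_metric_space) ex_close:
  assumes "x \<in> M" "0 < \<epsilon>"
  shows "\<exists>i. d x (s i) < \<epsilon>"
proof -
  have "x \<in> mtopology closure_of (range s)"
    using dense assms by simp
  then show ?thesis
    using assms(2) unfolding metric_closure_of by (fastforce simp: in_mball)
qed

lemma (in computable_metric_space) in_basic_ball_encode:
  assumes "0 < r"
  shows "\<exists>n. \<forall>x. x \<in> basic_ball M d s n \<longleftrightarrow> x \<in> M \<and> d (s i) x < of_rat r"
proof -
  obtain j where "pos_rat_decode j = r"
    using range_pos_rat_decode assms by (metis imageE mem_Collect_eq)
  then show ?thesis
    by (intro exI[of _ "prod_encode (i, j)"]) (auto simp: basic_ball_def in_mball s_in)
qed

text \<open>A ball that contains \<open>x\<close> and has radius below half of \<open>d x y\<close>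
  misses \<open>y\<close>.\<close>

lemma (in computable_metric_space) basic_balls_separate:
  assumes "x \<in> M" "y \<in> M" "\<And>n. x \<in> basic_ball M d s n \<longleftrightarrow> y \<in> basic_ball M d s n"
  shows "x = y"
proof (rule ccontr)
  assume "x \<noteq> y"
  then have "0 < d x y / 2"
    using assms by simp
  then obtain r :: rat where r: "0 < real_of_rat r" "real_of_rat r < d x y / 2"
    using of_rat_dense by blast
  then obtain i where i: "d x (s i) < of_rat r"
    using ex_close assms(1) by blast
  obtain n where "\<And>z. z \<in> basic_ball M d s n \<longleftrightarrow> z \<in> M \<and> d (s i) z < of_rat r"
    using in_basic_ball_encode[of r i] r(1) by auto
  then have "d (s i) y < of_rat r"
    using assms i by (metis commute)
  moreover have "d x y \<le> d x (s i) + d (s i) y"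
    using triangle assms s_in by blast
  ultimately show False
    using i r by simp
qed

text \<open>For two systems with the same code this is the graph of the equivariant bijection
  between them.\<close>

definition same_balls where
  "same_balls M d s K M' d' s' K' x y \<longleftrightarrow> x \<in> K \<and> y \<in> K' \<and>
    (\<forall>n. x \<in> basic_ball M d s n \<longleftrightarrow> y \<in> basic_ball M' d' s' n)"

text \<open>The inclusion says that \<open>x\<close> is at least as close to each \<open>s i\<close>
  as \<open>y\<close> is to \<open>s' i\<close>. As the mutual distances in the two dense sequences
  agree, the triangle inequality forces equality.\<close>

lemma basic_balls_subset_imp_eq:
  assumes "computable_metric_space M d s" "computable_metric_space M' d' s'"
    and dist: "\<And>i j. d (s i) (s j) = d' (s' i) (s' j)"
    and x: "x \<in> M" and y: "y \<in> M'"
    and sub: "\<And>n. y \<in> basic_ball M' d' s' n \<Longrightarrow> x \<in> basic_ball M d s n"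
  shows "x \<in> basic_ball M d s n \<longleftrightarrow> y \<in> basic_ball M' d' s' n"
proof -
  interpret M: computable_metric_space M d s by fact
  interpret M': computable_metric_space M' d' s' by fact
  have le: "d (s i) x \<le> d' (s' i) y" for i
  proof (rule ccontr)
    assume "\<not> ?thesis"
    then obtain r :: rat where r: "d' (s' i) y < of_rat r" "of_rat r < d (s i) x"
      using of_rat_dense by (metis not_le)
    then have "0 < real_of_rat r"
      using M'.nonneg order_le_less_trans by blast
    then have pos: "0 < r"
      by simp
    define j where "j = (SOME j. pos_rat_decode j = r)"
    have "pos_rat_decode j = r"
      unfolding j_def using range_pos_rat_decode pos by (metis (mono_tags, lifting) imageE mem_Collect_eq someI)
    then have "y \<in> basic_ball M' d' s' (prod_encode (i, j))" "x \<notin> basic_ball M d s (prod_encode (i, j))"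
      using r y by (auto simp: basic_ball_def M'.in_mball M.in_mball M'.s_in)
    then show False
      using sub by blast
  qed
  have "d' (s' i) y \<le> d (s i) x" for i
  proof (rule field_le_epsilon)
    fix \<epsilon> :: real assume "0 < \<epsilon>"
    then obtain j where j: "d' y (s' j) < \<epsilon> / 2"
      using M'.ex_close[OF y, of "\<epsilon> / 2"] by auto
    \<comment> \<open>\<open>s' j\<close> is within \<epsilon>/2 of \<open>y\<close>, hence by
      \<open>le\<close> also \<open>s j\<close> within \<epsilon>/2 of \<open>x\<close>; the detour
      through index \<open>j\<close> costs less than \<epsilon>.\<close>
    have "d' (s' i) y \<le> d (s i) (s j) + d' (s' j) y"
      using M'.triangle[OF M'.s_in M'.s_in y] dist by metis
    moreover have "d (s i) (s j) \<le> d (s i) x + d (s j) x"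
      using M.triangle[OF M.s_in x M.s_in] M.commute by metis
    ultimately show "d' (s' i) y \<le> d (s i) x + \<epsilon>"
      using le[of j] j M'.commute[of y "s' j"] by simp
  qed
  then have "d (s i) x = d' (s' i) y" for i
    using le by (simp add: order_antisym)
  then show ?thesis
    using x y by (auto simp: basic_ball_def M.in_mball M'.in_mball M.s_in M'.s_in split: prod.split)
qed

section \<open>Comparison of two systems with the same code\<close>

context
  fixes c G M d s K \<psi> M' d' s' K' \<psi>'
  assumes coded: "coded_action c G M d s K \<psi>" "coded_action c G M' d' s' K' \<psi>'"
begin

text \<open>One program approximates both distances to any precision, and its output is
  unique.\<close>

lemma same_dist: "d (s i) (s j) = d' (s' i) (s' j)"
proof (rule ccontr)
  assume neq: "d (s i) (s j) \<noteq> d' (s' i) (s' j)"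
  let ?e = "\<bar>d (s i) (s j) - d' (s' i) (s' j)\<bar>"
  obtain p q L where c: "c = (p, q, L)"
    by (cases c)
  obtain n where n: "(1 / 2) ^ n < ?e / 2"
    using real_arch_pow_inv[of "?e / 2" "1 / 2"] neq by auto
  have "\<exists>r. computes p [i, j, n] r \<and> \<bar>d (s i) (s j) - of_rat (rat_decode r)\<bar> \<le> 1 / 2 ^ n"
    using coded(1) by (simp add: coded_action_def c)
  then obtain r where r: "computes p [i, j, n] r" "\<bar>d (s i) (s j) - of_rat (rat_decode r)\<bar> \<le> 1 / 2 ^ n"
    by blast
  have "\<exists>r. computes p [i, j, n] r \<and> \<bar>d' (s' i) (s' j) - of_rat (rat_decode r)\<bar> \<le> 1 / 2 ^ n"
    using coded(2) by (simp add: coded_action_def c)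
  then obtain r' where r': "computes p [i, j, n] r'" "\<bar>d' (s' i) (s' j) - of_rat (rat_decode r')\<bar> \<le> 1 / 2 ^ n"
    by blast
  have "r' = r"
    using r r' computes_unique by blast
  then show False
    using r r' n by (simp add: power_one_over)
qed

text \<open>If each point of \<open>K'\<close> lay in a ball whose counterpart misses
  \<open>x\<close>, finitely many of these balls would cover \<open>K'\<close>. The common program
  \<open>q\<close> would halt on their indices, so the counterparts would cover \<open>K\<close>,
  including \<open>x\<close>.\<close>

lemma ex_same_balls:
  assumes x: "x \<in> K"
  shows "\<exists>y. same_balls M d s K M' d' s' K' x y"
proof -
  obtain p q L where c: "c = (p, q, L)"
    by (cases c)
  interpret M: computable_metric_space M d s
    using coded(1) by (simp add: coded_action_def c)
  interpret M': computable_metric_space M' d' s'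
    using coded(2) by (simp add: coded_action_def c)
  have K: "compactin M.mtopology K" "K \<subseteq> M"
    using coded(1) compactin_subset_topspace[of M.mtopology K] by (auto simp: coded_action_def c)
  have K': "compactin M'.mtopology K'" "K' \<subseteq> M'"
    using coded(2) compactin_subset_topspace[of M'.mtopology K'] by (auto simp: coded_action_def c)
  have "\<exists>y\<in>K'. \<forall>n. y \<in> basic_ball M' d' s' n \<longrightarrow> x \<in> basic_ball M d s n"
  proof (rule ccontr)
    assume "\<not> ?thesis"
    then have cover: "K' \<subseteq> \<Union> (basic_ball M' d' s' ` {n. x \<notin> basic_ball M d s n})"
      by auto
    have "openin M'.mtopology (basic_ball M' d' s' n)" for n
      by (auto simp: basic_ball_def split: prod.split)
    then obtain \<F> where \<F>: "finite \<F>" "\<F> \<subseteq> basic_ball M' d' s' ` {n. x \<notin> basic_ball M d s n}" "K' \<subseteq> \<Union> \<F>"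
      using K'(1) cover unfolding compactin_def by (metis (no_types, lifting) imageE)
    then obtain I where I: "finite I" "I \<subseteq> {n. x \<notin> basic_ball M d s n}" "\<F> = basic_ball M' d' s' ` I"
      by (meson finite_subset_image)
    then have "K' \<subseteq> (\<Union>n\<in>I. basic_ball M' d' s' n)"
      using \<F> by blast
    then have "halts q [set_encode I]"
      using coded(2) I(1) by (simp add: coded_action_def c)
    then have "K \<subseteq> (\<Union>n\<in>I. basic_ball M d s n)"
      using coded(1) I(1) by (simp add: coded_action_def c)
    then show False
      using x I(2) by auto
  qed
  then obtain y where y: "y \<in> K'" "\<And>n. y \<in> basic_ball M' d' s' n \<Longrightarrow> x \<in> basic_ball M d s n"
    by blast
  then have "x \<in> basic_ball M d s n \<longleftrightarrow> y \<in> basic_ball M' d' s' n" for n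
    using x K K'
    by (intro basic_balls_subset_imp_eq[OF M.computable_metric_space_axioms M'.computable_metric_space_axioms same_dist]) auto
  then show ?thesis
    using x y by (auto simp: same_balls_def)
qed

lemma same_balls_unique:
  assumes "same_balls M d s K M' d' s' K' x y" "same_balls M d s K M' d' s' K' x z"
  shows "y = z"
proof -
  obtain p q L where c: "c = (p, q, L)"
    by (cases c)
  interpret M': computable_metric_space M' d' s'
    using coded(2) by (simp add: coded_action_def c)
  have "K' \<subseteq> M'"
    using coded(2) compactin_subset_topspace[of M'.mtopology K'] by (auto simp: coded_action_def c)
  then show ?thesis
    using assms by (intro M'.basic_balls_separate) (auto simp: same_balls_def)
qed

text \<open>For a generator, one enumeration describes the preimages of corresponding balls in both
  systems. Products compose, and inverses follow from existence and uniqueness of partners.\<close>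

lemma same_balls_equivariant:
  assumes "g \<in> carrier G" "same_balls M d s K M' d' s' K' x y"
  shows "same_balls M d s K M' d' s' K' (\<psi> g x) (\<psi>' g y)"
proof -
  obtain p q L where c: "c = (p, q, L)"
    by (cases c)
  interpret \<psi>: group_action G K \<psi>
    using coded(1) by (simp add: coded_action_def c)
  interpret \<psi>': group_action G K' \<psi>'
    using coded(2) by (simp add: coded_action_def c)
  interpret group G
    using \<psi>.group_hom group_hom.axioms(1) by blast
  have L: "generate G (fst ` set L) = carrier G" "fst ` set L \<subseteq> carrier G"
    using coded(1) by (auto simp: coded_action_def c generating_set_def)
  have base: "same_balls M d s K M' d' s' K' (\<psi> g x) (\<psi>' g y)"
    if g: "g \<in> fst ` set L" and xy: "same_balls M d s K M' d' s' K' x y" for g x y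
  proof -
    obtain e where e: "(g, e) \<in> set L"
      using g by auto
    have K: "x \<in> K" "y \<in> K'"
      using xy by (auto simp: same_balls_def)
    have "\<psi> g x \<in> K" "\<psi>' g y \<in> K'"
      using K g L \<psi>.element_image \<psi>'.element_image by blast+
    moreover have "\<psi> g x \<in> basic_ball M d s m \<longleftrightarrow> \<psi>' g y \<in> basic_ball M' d' s' m" for m
    proof -
      have "{y \<in> K. \<psi> g y \<in> basic_ball M d s m} = (\<Union>n\<in>enumerated e m. basic_ball M d s n) \<inter> K"
        using coded(1) e unfolding coded_action_def c by blast
      moreover have "{y \<in> K'. \<psi>' g y \<in> basic_ball M' d' s' m} =
          (\<Union>n\<in>enumerated e m. basic_ball M' d' s' n) \<inter> K'"
        using coded(2) e unfolding coded_action_def c by blast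
      ultimately have "\<psi> g x \<in> basic_ball M d s m \<longleftrightarrow> (\<exists>n\<in>enumerated e m. x \<in> basic_ball M d s n)"
        "\<psi>' g y \<in> basic_ball M' d' s' m \<longleftrightarrow> (\<exists>n\<in>enumerated e m. y \<in> basic_ball M' d' s' n)"
        using K by blast+
      then show ?thesis
        using xy by (simp add: same_balls_def)
    qed
    ultimately show ?thesis
      by (simp add: same_balls_def)
  qed
  have "g \<in> generate G (fst ` set L)"
    using assms L by simp
  then show ?thesis
    using assms(2)
  proof (induction arbitrary: x y)
    case one
    then show ?case
      by (simp add: same_balls_def \<psi>.id_eq_one[symmetric] \<psi>'.id_eq_one[symmetric])
  next
    case (incl h)
    then show ?case by (rule base)
  next
    case (inv h)
    then have h: "h \<in> carrier G" and K: "x \<in> K" "y \<in> K'"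
      using L by (auto simp: same_balls_def)
    have "\<psi> (inv\<^bsub>G\<^esub> h) x \<in> K"
      using h K \<psi>.element_image by blast
    \<comment> \<open>Applying \<open>h\<close> to this pair gives a partner of \<open>x\<close>,
      which must be \<open>y\<close>; so \<open>z\<close> is the inverse of \<open>h\<close> applied
      to \<open>y\<close>.\<close>
    then obtain z where z: "same_balls M d s K M' d' s' K' (\<psi> (inv\<^bsub>G\<^esub> h) x) z"
      using ex_same_balls by blast
    have "\<psi> h (\<psi> (inv\<^bsub>G\<^esub> h) x) = x"
      using \<psi>.orbit_sym_aux[of "inv\<^bsub>G\<^esub> h" x] h K by simp
    then have "\<psi>' h z = y"
      using base[OF inv(1) z] inv(2) same_balls_unique by metis
    then have "\<psi>' (inv\<^bsub>G\<^esub> h) y = z"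
      using \<psi>'.orbit_sym_aux[OF h _] z by (auto simp: same_balls_def)
    then show ?case
      using z by simp
  next
    case (eng h1 h2)
    then have h: "h1 \<in> carrier G" "h2 \<in> carrier G"
      using L by auto
    have "x \<in> K" "y \<in> K'"
      using eng.prems by (auto simp: same_balls_def)
    then show ?case
      using eng h by (simp add: \<psi>.composition_rule \<psi>'.composition_rule)
  qed
qed

end

text \<open>If \<open>g\<close> fixes \<open>x\<close>, both \<open>y\<close> and its image under
  \<open>g\<close> are partners of \<open>x\<close>, hence equal. The converse exchanges the roles
  of the systems.\<close>

lemma coded_action_stabilizer:
  assumes c: "coded_action c G M d s K \<psi>" and c': "coded_action c G M' d' s' K' \<psi>'"
    and x: "x \<in> K"
  shows "\<exists>y\<in>K'. \<forall>g\<in>carrier G. \<psi> g x = x \<longleftrightarrow> \<psi>' g y = y"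
proof -
  obtain y where y: "same_balls M d s K M' d' s' K' x y"
    using ex_same_balls[OF c c' x] by blast
  then have y': "same_balls M' d' s' K' M d s K y x"
    by (auto simp: same_balls_def)
  have "\<psi> g x = x \<longleftrightarrow> \<psi>' g y = y" if g: "g \<in> carrier G" for g
    using same_balls_equivariant[OF c c' g y] y y' same_balls_unique[OF c c'] same_balls_unique[OF c' c]
      same_balls_equivariant[OF c' c g y'] by metis
  then show ?thesis
    using y by (auto simp: same_balls_def)
qed

section \<open>Index sets recovered from stabilizers\<close>

text \<open>\<open>A\<close> is expressed through stabilizers alone, here those equal to the
  multiples of n + 2, so that it is the same for all systems with code \<open>c\<close>.\<close>

definition orbit_index_code :: "recf \<times> recf \<times> (nat \<times> recf) list \<Rightarrow> nat set \<Rightarrow> bool" where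
  "orbit_index_code c A \<longleftrightarrow>
    (\<exists>(M :: (nat \<Rightarrow> real) set) d s K \<psi>. coded_action c int_group M d s K \<psi> \<and>
      A = {n. \<exists>x\<in>K. \<forall>g\<in>carrier int_group. \<psi> g x = x \<longleftrightarrow> int n + 2 dvd int_decode g})"

lemma orbit_index_code_unique:
  assumes "orbit_index_code c A" "orbit_index_code c A'"
  shows "A = A'"
proof -
  have "A \<subseteq> A'" if A: "orbit_index_code c A" "orbit_index_code c A'" for A A'
  proof -
    obtain M :: "(nat \<Rightarrow> real) set" and d s K \<psi> where 1: "coded_action c int_group M d s K \<psi>"
      "A = {n. \<exists>x\<in>K. \<forall>g\<in>carrier int_group. \<psi> g x = x \<longleftrightarrow> int n + 2 dvd int_decode g}"
      using A(1) unfolding orbit_index_code_def by (elim exE conjE)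
    obtain M' :: "(nat \<Rightarrow> real) set" and d' s' K' \<psi>' where 2: "coded_action c int_group M' d' s' K' \<psi>'"
      "A' = {n. \<exists>x\<in>K'. \<forall>g\<in>carrier int_group. \<psi>' g x = x \<longleftrightarrow> int n + 2 dvd int_decode g}"
      using A(2) unfolding orbit_index_code_def by (elim exE conjE)
    show ?thesis
      unfolding 1(2) 2(2) using coded_action_stabilizer[OF 1(1) 2(1)] by fastforce
  qed
  then show ?thesis
    using assms by blast
qed

text \<open>Different orbits have different sizes, and the size is the positive generator of the
  stabilizer.\<close>

lemma orbit_action_stabilizer:
  "(\<exists>u\<in>orbits A. \<forall>g\<in>carrier int_group. orbit_action A g u = u \<longleftrightarrow> int n + 2 dvd int_decode g) \<longleftrightarrow> n \<in> A"
    (is "?L \<longleftrightarrow> _")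
proof
  assume ?L
  then obtain u where u: "u \<in> orbits A"
    "\<And>t. rotation t u = u \<longleftrightarrow> int n + 2 dvd t"
    by (simp add: int_group_def) (metis int_encode_inverse)
  from u(1) show "n \<in> A"
  proof (cases rule: orbits_cases)
    case 1
    then show ?thesis
      \<comment> \<open>The limit point is fixed by 1, which no n + 2 divides; orbit sizes start at
        2 for this reason.\<close>
      using u(2)[of 1] zdvd_imp_le[of "int n + 2" 1] by simp
  next
    case (2 m t)
    have "int m + 2 dvd k \<longleftrightarrow> int n + 2 dvd k" for k
      using u(2)[of k] rotation_fixes_orbit_point[of k m t] unfolding 2 by metis
    then have "int n + 2 dvd int m + 2" "int m + 2 dvd int n + 2"
      using dvd_refl by blast+
    then have "int n + 2 = int m + 2"
      by (intro zdvd_antisym_nonneg) auto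
    then show ?thesis
      using 2 by simp
  qed
next
  assume "n \<in> A"
  then show ?L
    by (intro bexI[of _ "orbit_point n 0"]) (simp_all add: rotation_fixes_orbit_point del: rotation_orbit_point)
qed

text \<open>A conjugacy is injective and equivariant, so it preserves stabilizers and
  \<open>A\<close> can be read off from the computable copy.\<close>

lemma effective_imp_orbit_index_code:
  assumes "effective_dynamical_system int_group (orbit_topology A) (orbit_action A)"
  shows "\<exists>c. orbit_index_code c A"
proof -
  obtain M :: "(nat \<Rightarrow> real) set" and d s K \<psi> h where
    act: "computable_action int_group M d s K \<psi>" and
    conj: "topological_conjugacy int_group (orbit_topology A) (orbit_action A)
      (subtopology (Metric_space.mtopology M d) K) \<psi> h"
    using assms unfolding effective_dynamical_system_def by blast
  interpret computable_metric_space M d s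
    using act by (simp add: computable_action_def)
  have "K \<subseteq> M"
    using act compactin_subset_topspace by (fastforce simp: computable_action_def recursively_compact_def)
  then have K: "h ` orbits A = K" and inj: "inj_on h (orbits A)"
    using conj homeomorphic_imp_injective_map homeomorphic_imp_surjective_map
    by (fastforce simp: topological_conjugacy_def)+
  have equi: "h (orbit_action A g u) = \<psi> g (h u)" if "g \<in> carrier int_group" "u \<in> orbits A" for g u
    using conj that by (simp add: topological_conjugacy_def topological_factor_map_def)
  have "\<psi> g (h u) = h u \<longleftrightarrow> orbit_action A g u = u" if "g \<in> carrier int_group" "u \<in> orbits A" for g u
    using inj_onD[OF inj, of "orbit_action A g u" u] equi[OF that] that(2)
    by (auto simp: rotation_in_orbits)
  then have "A = {n. \<exists>x\<in>K. \<forall>g\<in>carrier int_group. \<psi> g x = x \<longleftrightarrow> int n + 2 dvd int_decode g}"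
    unfolding K[symmetric] by (simp add: orbit_action_stabilizer del: orbit_action_eq)
  moreover obtain c where "coded_action c int_group M d s K \<psi>"
    using computable_action_coded[OF act] by blast
  ultimately show ?thesis
    unfolding orbit_index_code_def by blast
qed

text \<open>Choosing a code for every \<open>A\<close> would inject the power set of the natural
  numbers into the natural numbers. No particular \<open>A\<close> is exhibited.\<close>

lemma ex_not_effective:
  "\<exists>A. \<not> effective_dynamical_system int_group (orbit_topology A) (orbit_action A)"
proof (rule ccontr)
  assume "\<not> ?thesis"
  then obtain c where c: "\<And>A. orbit_index_code (c A) A"
    using effective_imp_orbit_index_code by metis
  have "inj (\<lambda>A. to_nat (c A))"
    using c orbit_index_code_unique by (metis (no_types, lifting) injI to_nat_split)
  then have "surj (inv_into UNIV (\<lambda>A. to_nat (c A)))"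
    by (rule inj_imp_surj_inv)
  then show False
    using Cantors_theorem[of "UNIV :: nat set"] by (metis Pow_UNIV)
qed

theorem proposition8p2:
  shows "\<exists>(\<Gamma> :: nat monoid) (X :: (nat \<Rightarrow> real) topology) \<alpha> (Y :: (nat \<Rightarrow> real) topology) \<beta>.
    finitely_generated \<Gamma> \<and>
    effective_dynamical_system \<Gamma> X \<alpha> \<and>
    compact_space Y \<and> metrizable_space Y \<and> topological_action \<Gamma> Y \<beta> \<and>
    (\<exists>f. topological_factor_map \<Gamma> X \<alpha> Y \<beta> f) \<and>
    \<not> effective_dynamical_system \<Gamma> Y \<beta>"
  using ex_not_effective finitely_generated_int_group effective_dynamical_system_orbits
    compact_space_orbit_topology metrizable_space_orbit_topology topological_action_orbit_action
    topological_factor_map_orbits[OF subset_UNIV] by blast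

end
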